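(* Let $k$ be a field of characteristic zero and ${\boldsymbol\lambda}=(\lambda_{ij}),{\boldsymbol\mu}\in M_n(k)$ antisymmetric, and assume one of the following: (a) ${\boldsymbol\lambda}\in GL_n(k)$; (b) the subgroup $\sum_{i,j=1}^n\mathbb Z\lambda_{ij}$ of $(k,+)$ is cyclic; (c) the subgroup $\sum_{i,j=1}^n\mathbb Z\lambda_{ij}$ of $(k,+)$ is free abelian of rank $n(n-1)/2$. Then $k_{\boldsymbol\lambda}(x_1,\dots,x_n)\cong k_{\boldsymbol\mu}(x_1,\dots,x_n)$ as Poisson algebras over $k$ if and only if there exists $A\in GL_n(\mathbb Z)$ with ${\boldsymbol\mu}=A{\boldsymbol\lambda}A^{\mathrm{tr}}$.
   Context: For antisymmetric ${\boldsymbol\lambda}\in M_n(k)$, $k_{\boldsymbol\lambda}(x_1,\dots,x_n)$ is the rational function field $k(x_1,\dots,x_n)$ with the unique Poisson bracket satisfying $\{x_i,x_j\}=\lambda_{ij}x_ix_j$ for all $i,j$. *)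

theory Defs
  imports "HOL-Analysis.Finite_Cartesian_Product" "HOL-Library.Poly_Mapping"
    "HOL-Computational_Algebra.Fraction_Field"
begin

text \<open>Polynomials over k in the variables x_i (i ranging over the finite index type 'n,
  so n = CARD('n)): a polynomial is a finitely supported map from monomials
  (exponent vectors 'n =>0 nat) to coefficients. The rational function field
  k(x_1,...,x_n) is its fraction field.\<close>

type_synonym ('n, 'k) mpoly = "('n \<Rightarrow>\<^sub>0 nat) \<Rightarrow>\<^sub>0 'k"
type_synonym ('n, 'k) ratfun = "('n, 'k) mpoly fract"

definition rf_const :: "'k::field \<Rightarrow> ('n::{finite,linorder}, 'k) ratfun" where
  "rf_const c = Fract (Poly_Mapping.single 0 c) 1"

definition rf_var :: "'n::{finite,linorder} \<Rightarrow> ('n, 'k::field) ratfun" where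
  "rf_var i = Fract (Poly_Mapping.single (Poly_Mapping.single i 1) 1) 1"

definition mp_pderiv :: "'n::linorder \<Rightarrow> ('n, 'k::comm_semiring_1) mpoly \<Rightarrow> ('n, 'k) mpoly" where
  "mp_pderiv i p = (\<Sum>(m :: 'n \<Rightarrow>\<^sub>0 nat)\<in>Poly_Mapping.keys p.
      Poly_Mapping.single (m - Poly_Mapping.single i 1) (of_nat (Poly_Mapping.lookup m i) * Poly_Mapping.lookup p m))"

definition rf_pderiv :: "'n::{finite,linorder} \<Rightarrow> ('n, 'k::field) ratfun \<Rightarrow> ('n, 'k) ratfun" where
  "rf_pderiv i F = (let (p, q) = (SOME (p, q). q \<noteq> 0 \<and> F = Fract p q) in
      Fract (mp_pderiv i p * q - p * mp_pderiv i q) (q * q))"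

text \<open>The Poisson bracket of k_lambda(x_1,...,x_n): the unique biderivation with
  {x_i, x_j} = lambda_ij x_i x_j, i.e. {f,g} = sum_ij lambda_ij x_i x_j (d_i f)(d_j g).\<close>
definition pbracket ::
  "('k::field^'n::{finite,linorder})^('n::{finite,linorder}) \<Rightarrow> ('n, 'k) ratfun \<Rightarrow> ('n, 'k) ratfun \<Rightarrow> ('n, 'k) ratfun" where
  "pbracket L F G = (\<Sum>i\<in>UNIV. \<Sum>j\<in>UNIV.
      rf_const (L $ i $ j) * rf_var i * rf_var j * rf_pderiv i F * rf_pderiv j G)"

definition poisson_iso ::
  "('k::field^'n::{finite,linorder})^('n::{finite,linorder}) \<Rightarrow> ('k::field^'n::{finite,linorder})^('n::{finite,linorder}) \<Rightarrow> (('n, 'k) ratfun \<Rightarrow> ('n, 'k) ratfun) \<Rightarrow> bool" where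
  "poisson_iso L M \<phi> \<longleftrightarrow> bij \<phi> \<and>
     (\<forall>F G. \<phi> (F + G) = \<phi> F + \<phi> G) \<and>
     (\<forall>F G. \<phi> (F * G) = \<phi> F * \<phi> G) \<and>
     \<phi> 1 = 1 \<and>
     (\<forall>c F. \<phi> (rf_const c * F) = rf_const c * \<phi> F) \<and>
     (\<forall>F G. \<phi> (pbracket L F G) = pbracket M (\<phi> F) (\<phi> G))"

definition poisson_isomorphic :: "('k::field^'n::{finite,linorder})^('n::{finite,linorder}) \<Rightarrow> ('k::field^'n::{finite,linorder})^('n::{finite,linorder}) \<Rightarrow> 'n itself \<Rightarrow> bool" where
  "poisson_isomorphic L M _ \<longleftrightarrow>
     (\<exists>\<phi> :: ('n, 'k) ratfun \<Rightarrow> ('n, 'k) ratfun. poisson_iso L M \<phi>)"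

definition antisymmetric_mat :: "'k::ab_group_add^'n^'n \<Rightarrow> bool" where
  "antisymmetric_mat L \<longleftrightarrow> transpose L = - L"

definition entry_subgroup :: "'k::ring_1^'n^'n \<Rightarrow> 'k set" where
  "entry_subgroup L =
     {(\<Sum>i\<in>UNIV. \<Sum>j\<in>UNIV. of_int (c i j) * L $ i $ j) | c :: 'n \<Rightarrow> 'n \<Rightarrow> int. True}"

definition cyclic_subgroup :: "'k::ring_1 set \<Rightarrow> bool" where
  "cyclic_subgroup G \<longleftrightarrow> (\<exists>g. G = range (\<lambda>m::int. of_int m * g))"

definition free_abelian_rank :: "'k::ring_1 set \<Rightarrow> nat \<Rightarrow> bool" where
  "free_abelian_rank G r \<longleftrightarrow> (\<exists>b :: nat \<Rightarrow> 'k.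
     G = {(\<Sum>l<r. of_int (c l) * b l) | c :: nat \<Rightarrow> int. True} \<and>
     (\<forall>c :: nat \<Rightarrow> int. (\<Sum>l<r. of_int (c l) * b l) = 0 \<longrightarrow> (\<forall>l<r. c l = 0)))"

definition int_mat_to :: "int^'n^'m \<Rightarrow> 'k::ring_1^'n^'m" where
  "int_mat_to A = (\<chi> i j. of_int (A $ i $ j))"

end

theory Submission
  imports "HOL-Analysis.Determinants" Defs (* this order keeps transpose from denoting Transposition.transpose *)
begin

text \<open>
  Let \<open>y\<^sub>a = P\<^sub>a / Q\<^sub>a\<close> be the image of \<open>x\<^sub>a\<close> under a Poisson isomorphism.  In terms of the Euler derivations
  \<open>x\<^sub>i \<partial>/\<partial>x\<^sub>i\<close>, which scale each monomial by an exponent, the relations among the \<open>y\<^sub>a\<close> become polynomial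
  identities once denominators are cleared, and comparing leading coefficients for the lexicographic order
  gives \<open>L = B M B\<^sup>T\<close> with \<open>B\<close> the integer matrix of leading exponents of the \<open>y\<^sub>a\<close>.  The inverse
  isomorphism gives \<open>M = A L A\<^sup>T\<close>, so \<open>L = C L C\<^sup>T\<close> with \<open>C = B A\<close>.

  If \<open>L\<close> is invertible, then \<open>det C = \<plusminus>1\<close>.  If the entries of \<open>L\<close> generate a group of rank \<open>n(n-1)/2\<close>, they are
  independent over the integers, so the 2x2 minors of \<open>C\<close> are those of the identity and \<open>C\<close> is unimodular again.
  In the cyclic case \<open>L\<close> and \<open>M\<close> are multiples of integer matrices; after unimodular changes of basis that
  split off the radicals, the blocks of \<open>A\<close> and \<open>B\<close> between the nondegenerate parts are unimodular, and the
  block of \<open>A\<close> can be completed to a unimodular matrix.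

  Conversely, a unimodular congruence is realised by the monomial substitution whose exponents are the rows of
  \<open>A\<^sup>-\<^sup>1\<close>.
\<close>

section \<open>Euler derivations and leading coefficients\<close>

text \<open>The derivation \<open>x_i d/dx_i\<close>, given coefficientwise: it moves no exponent,
  so it avoids the truncated subtraction of \<open>mp_pderiv\<close> and preserves bounds on the
  monomials.\<close>

definition euler :: "'n \<Rightarrow> ('n, 'k::comm_semiring_1) mpoly \<Rightarrow> ('n, 'k) mpoly" where
  "euler i p = Poly_Mapping.mapp (\<lambda>m c. of_nat (Poly_Mapping.lookup m i) * c) p"

lemma lookup_euler:
  "Poly_Mapping.lookup (euler i p) m = of_nat (Poly_Mapping.lookup m i) * Poly_Mapping.lookup p m"
  by (simp add: euler_def lookup_mapp when_def in_keys_iff)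

lemma mpoly_eq_sum_monomials:
  "p = (\<Sum>m\<in>Poly_Mapping.keys p. Poly_Mapping.single m (Poly_Mapping.lookup p m))"
  by (rule poly_mapping_eqI)
    (simp add: lookup_sum lookup_single when_def sum.delta in_keys_iff)

lemma euler_single:
  "euler i (Poly_Mapping.single m c) = Poly_Mapping.single m (of_nat (Poly_Mapping.lookup m i) * c)"
  by (rule poly_mapping_eqI) (auto simp: lookup_euler lookup_single when_def)

lemma euler_add: "euler i (p + q) = euler i p + euler i q"
  by (rule poly_mapping_eqI) (simp add: lookup_euler lookup_add distrib_left)

lemma euler_0: "euler i 0 = 0"
  by (rule poly_mapping_eqI) (simp add: lookup_euler)

lemma euler_sum: "euler i (sum f A) = (\<Sum>a\<in>A. euler i (f a))"
  by (induction A rule: infinite_finite_induct) (simp_all add: euler_0 euler_add)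

text \<open>Both sides are biadditive, so monomials suffice; there the exponents of the factors add
  up.\<close>

lemma euler_mult:
  fixes p q :: "('n, 'k::comm_semiring_1) mpoly"
  shows "euler i (p * q) = euler i p * q + p * euler i q"
proof -
  have mono: "euler i (Poly_Mapping.single m c * Poly_Mapping.single m' c')
     = euler i (Poly_Mapping.single m c) * Poly_Mapping.single m' c'
      + Poly_Mapping.single m c * euler i (Poly_Mapping.single m' c')"
    for m m' :: "'n \<Rightarrow>\<^sub>0 nat" and c c' :: 'k
    by (simp add: mult_single euler_single lookup_add single_add[symmetric] algebra_simps)
  define P where "P m = Poly_Mapping.single m (Poly_Mapping.lookup p m)" for m
  define Q where "Q m = Poly_Mapping.single m (Poly_Mapping.lookup q m)" for m
  have p: "p = sum P (Poly_Mapping.keys p)" and q: "q = sum Q (Poly_Mapping.keys q)"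
    unfolding P_def Q_def by (rule mpoly_eq_sum_monomials)+
  \<comment> \<open>Arbitrary index sets are used because rewriting \<open>p\<close> as
    \<open>sum P (Poly_Mapping.keys p)\<close> directly would also hit the \<open>p\<close> inside
    \<open>keys\<close>.\<close>
  have "euler i (sum P A * sum Q B) = euler i (sum P A) * sum Q B + sum P A * euler i (sum Q B)" for A B
    by (simp add: euler_sum sum_product mono P_def Q_def sum.distrib)
  from this[of "Poly_Mapping.keys p" "Poly_Mapping.keys q"] show ?thesis
    by (simp add: p[symmetric] q[symmetric])
qed

lemma var_mult_mp_pderiv:
  fixes p :: "('n::linorder, 'k::comm_semiring_1) mpoly"
  shows "Poly_Mapping.single (Poly_Mapping.single i 1) 1 * mp_pderiv i p = euler i p"
proof -
  have *: "Poly_Mapping.single (Poly_Mapping.single i 1) 1 *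
      Poly_Mapping.single (m - Poly_Mapping.single i 1) (of_nat (Poly_Mapping.lookup m i) * c)
    = Poly_Mapping.single m (of_nat (Poly_Mapping.lookup m i) * c)" for m :: "'n \<Rightarrow>\<^sub>0 nat" and c :: 'k
  \<comment> \<open>For exponent 0 the truncated difference gives a wrong monomial, but its
    coefficient is 0.\<close>
  proof (cases "Poly_Mapping.lookup m i = 0")
    case False
    then have "Poly_Mapping.single i 1 + (m - Poly_Mapping.single i 1) = m"
      by (intro poly_mapping_eqI) (auto simp: lookup_add lookup_minus lookup_single when_def)
    then show ?thesis by (simp add: mult_single)
  qed simp
  have "euler i p = (\<Sum>m\<in>Poly_Mapping.keys p. euler i (Poly_Mapping.single m (Poly_Mapping.lookup p m)))"
    by (subst mpoly_eq_sum_monomials[of p]) (simp add: euler_sum)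
  then show ?thesis
    by (simp add: mp_pderiv_def sum_distrib_left *[unfolded One_nat_def] euler_single)
qed

section \<open>Rational functions as quotients, and the Euler derivations on them\<close>

definition rf_poly :: "('n::{finite,linorder}, 'k::field) mpoly \<Rightarrow> ('n, 'k) ratfun" where
  "rf_poly p = Fract p 1"

lemma rf_poly_simps:
  "rf_poly (p + q) = rf_poly p + rf_poly q"
  "rf_poly (p - q) = rf_poly p - rf_poly q"
  "rf_poly (p * q) = rf_poly p * rf_poly q"
  "rf_poly 0 = 0" "rf_poly 1 = 1"
  "rf_poly p = 0 \<longleftrightarrow> p = 0"
  "rf_poly p = rf_poly q \<longleftrightarrow> p = q"
  by (simp_all add: rf_poly_def fract_expand eq_fract)

lemma Fract_eq_divide: "Fract p q = rf_poly p / rf_poly q"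
  by (simp add: rf_poly_def)

lemma rf_poly_sum: "rf_poly (sum f A) = (\<Sum>a\<in>A. rf_poly (f a))"
  by (induction A rule: infinite_finite_induct) (simp_all add: rf_poly_simps)

lemma ratfun_cases:
  fixes F :: "('n::{finite,linorder}, 'k::field) ratfun"
  obtains p q where "q \<noteq> 0" "F = rf_poly p / rf_poly q"
  by (cases F) (metis Fract_eq_divide)

definition rf_euler :: "'n::{finite,linorder} \<Rightarrow> ('n, 'k::field) ratfun \<Rightarrow> ('n, 'k) ratfun" where
  "rf_euler i F = rf_var i * rf_pderiv i F"

text \<open>\<open>rf_pderiv\<close> differentiates a representative picked by \<open>SOME\<close>;
  this quotient rule holds for every representative, so the choice can be forgotten from here
  on.\<close>

lemma rf_euler_divide:
  fixes p q :: "('n::{finite,linorder}, 'k::field) mpoly"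
  assumes q: "q \<noteq> 0"
  shows "rf_euler i (rf_poly p / rf_poly q) =
    (rf_poly (euler i p) * rf_poly q - rf_poly p * rf_poly (euler i q)) / (rf_poly q * rf_poly q)"
proof -
  let ?F = "rf_poly p / rf_poly q"
  obtain a b where ab: "(SOME (a, b). b \<noteq> 0 \<and> ?F = Fract a b) = (a, b)" by force
  have "\<exists>x. case x of (a, b) \<Rightarrow> b \<noteq> 0 \<and> ?F = Fract a b"
    using q Fract_eq_divide[of p q] by (intro exI[of _ "(p, q)"]) simp
  from someI_ex[OF this] have b: "b \<noteq> 0" and F: "?F = Fract a b"
    by (auto simp: ab)
  have "rf_pderiv i ?F = Fract (mp_pderiv i a * b - a * mp_pderiv i b) (b * b)"
    by (simp add: rf_pderiv_def ab)
  then have "rf_euler i ?F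
      = Fract (Poly_Mapping.single (Poly_Mapping.single i 1) 1 * (mp_pderiv i a * b - a * mp_pderiv i b)) (b * b)"
    by (simp add: rf_euler_def rf_var_def)
  also have "\<dots> = Fract (euler i a * b - a * euler i b) (b * b)"
    by (simp add: var_mult_mp_pderiv[symmetric] algebra_simps)
  also have "\<dots> = (rf_poly (euler i p) * rf_poly q - rf_poly p * rf_poly (euler i q)) / (rf_poly q * rf_poly q)"
  proof -
    have "Fract p q = Fract a b" using F by (simp add: Fract_eq_divide)
    then have eq: "p * b = a * q" using q b by (simp add: eq_fract)
    \<comment> \<open>Differentiating the cross-multiplied relation \<open>p * b = a * q\<close> is
      what makes the quotient formulas of the two representatives agree.\<close>
    then have "euler i p * b + p * euler i b = euler i a * q + a * euler i q"
      using euler_mult[of i p b] euler_mult[of i a q] by simp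
    then have e2: "euler i a * q = euler i p * b + p * euler i b - a * euler i q"
      by simp
    have "(euler i a * b - a * euler i b) * (q * q) = (euler i a * q) * b * q - (a * q) * q * euler i b"
      by (simp add: algebra_simps)
    also have "\<dots> = (euler i p * b + p * euler i b - a * euler i q) * b * q - p * b * q * euler i b"
      by (simp add: e2 eq[symmetric])
    also have "\<dots> = euler i p * b * b * q - (a * q) * b * euler i q"
      by (simp add: algebra_simps)
    also have "\<dots> = (euler i p * q - p * euler i q) * (b * b)"
      by (simp add: eq[symmetric] algebra_simps)
    finally have "Fract (euler i a * b - a * euler i b) (b * b) = Fract (euler i p * q - p * euler i q) (q * q)"
      using q b by (simp add: eq_fract)
    then show ?thesis by (simp add: Fract_eq_divide rf_poly_simps)
  qed
  finally show ?thesis .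
qed

lemma rf_euler_rf_poly: "rf_euler i (rf_poly p) = rf_poly (euler i p)"
proof -
  have "euler i 1 = (0 :: ('a, 'b) mpoly)"
    by (simp add: single_one[symmetric] euler_single del: single_one)
  then show ?thesis using rf_euler_divide[of 1 i p] by (simp add: rf_poly_simps)
qed

lemma rf_euler_add: "rf_euler i (F + G) = rf_euler i F + rf_euler i G"
proof -
  obtain a b where b: "b \<noteq> 0" and F: "F = rf_poly a / rf_poly b" by (rule ratfun_cases)
  obtain c d where d: "d \<noteq> 0" and G: "G = rf_poly c / rf_poly d" by (rule ratfun_cases)
  have "F + G = rf_poly (a * d + c * b) / rf_poly (b * d)"
    using b d by (simp add: F G rf_poly_simps field_simps)
  then have "rf_euler i (F + G) = (rf_poly (euler i (a * d + c * b)) * rf_poly (b * d) -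
      rf_poly (a * d + c * b) * rf_poly (euler i (b * d))) / (rf_poly (b * d) * rf_poly (b * d))"
    using b d by (simp only: rf_euler_divide mult_eq_0_iff simp_thms)
  then show ?thesis
    using b d by (simp add: F G rf_euler_divide) (simp add: rf_poly_simps euler_add euler_mult field_simps)
qed

lemma rf_euler_mult: "rf_euler i (F * G) = rf_euler i F * G + F * rf_euler i G"
proof -
  obtain a b where b: "b \<noteq> 0" and F: "F = rf_poly a / rf_poly b" by (rule ratfun_cases)
  obtain c d where d: "d \<noteq> 0" and G: "G = rf_poly c / rf_poly d" by (rule ratfun_cases)
  have "F * G = rf_poly (a * c) / rf_poly (b * d)"
    using b d by (simp add: F G rf_poly_simps)
  then have "rf_euler i (F * G) = (rf_poly (euler i (a * c)) * rf_poly (b * d) -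
      rf_poly (a * c) * rf_poly (euler i (b * d))) / (rf_poly (b * d) * rf_poly (b * d))"
    using b d by (simp only: rf_euler_divide mult_eq_0_iff simp_thms)
  then show ?thesis
    using b d by (simp add: F G rf_euler_divide) (simp add: rf_poly_simps euler_add euler_mult field_simps)
qed

lemma rf_const_eq: "rf_const c = rf_poly (Poly_Mapping.single 0 c)"
  by (simp add: rf_const_def rf_poly_def)

lemma rf_var_eq: "rf_var i = rf_poly (Poly_Mapping.single (Poly_Mapping.single i 1) 1)"
  by (simp add: rf_var_def rf_poly_def)

lemma rf_const_simps:
  "rf_const (c + d) = rf_const c + rf_const d"
  "rf_const (c * d) = rf_const c * rf_const d"
  "rf_const 0 = 0" "rf_const 1 = 1"
  "rf_const c = rf_const d \<longleftrightarrow> c = d"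
  by (auto simp: rf_const_eq rf_poly_simps(1,3)[symmetric] single_add mult_single)
    (auto simp: rf_poly_simps dest: arg_cong[of _ _ "\<lambda>p. Poly_Mapping.lookup p 0"])

lemma rf_const_sum: "rf_const (sum f A) = (\<Sum>a\<in>A. rf_const (f a))"
  by (induction A rule: infinite_finite_induct) (simp_all add: rf_const_simps)

lemma rf_const_uminus: "rf_const (- c) = - rf_const c"
  using rf_const_simps(1)[of "-c" c] by (simp add: rf_const_simps eq_neg_iff_add_eq_0)

lemma rf_const_of_nat: "rf_const (of_nat n) = of_nat n"
  by (induction n) (simp_all add: rf_const_simps)

lemma rf_const_of_int: "rf_const (of_int z) = of_int z"
  by (cases z rule: int_cases2) (simp_all add: rf_const_of_nat rf_const_uminus)

lemma rf_var_nonzero: "rf_var i \<noteq> 0"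
  by (simp add: rf_var_eq rf_poly_simps inj_eq[OF inj_single, of _ 0, simplified])

lemma rf_euler_const: "rf_euler i (rf_const c) = 0"
  by (simp add: rf_const_eq rf_euler_rf_poly euler_single rf_poly_simps)

lemma rf_euler_var: "rf_euler i (rf_var j) = (if i = j then rf_var j else 0)"
  by (simp add: rf_var_eq rf_euler_rf_poly euler_single lookup_single rf_poly_simps)

text \<open>Each variable is absorbed into its partial derivative, which leaves a bracket with
  constant coefficients.\<close>

lemma pbracket_euler:
  "pbracket L F G = (\<Sum>i\<in>UNIV. \<Sum>j\<in>UNIV. rf_const (L $ i $ j) * rf_euler i F * rf_euler j G)"
  unfolding pbracket_def rf_euler_def by (simp add: mult_ac)

lemma pbracket_var: "pbracket L (rf_var i) (rf_var j) = rf_const (L $ i $ j) * rf_var i * rf_var j"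
  by (simp add: pbracket_euler rf_euler_var if_distrib[of "\<lambda>x. x * _"] if_distrib[of "\<lambda>x. _ * x"]
      sum.delta sum.delta' cong: if_cong)

section \<open>Leading monomials for the lexicographic order\<close>

definition keys_le :: "('n::linorder, 'k::zero) mpoly \<Rightarrow> ('n \<Rightarrow>\<^sub>0 nat) \<Rightarrow> bool" where
  "keys_le p m \<longleftrightarrow> (\<forall>m'\<in>Poly_Mapping.keys p. m' \<le> m)"

text \<open>The order is compatible with addition, so only the pair \<open>m\<close>,
  \<open>m'\<close> of exponents can produce \<open>m + m'\<close>. The bounds need not be attained:
  after \<open>euler\<close> or a difference the coefficient at the bound may vanish.\<close>

lemma keys_le_mult:
  fixes p q :: "('n::linorder, 'k::comm_semiring_1) mpoly"
  assumes "keys_le p m" "keys_le q m'"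
  shows "keys_le (p * q) (m + m')"
    and "Poly_Mapping.lookup (p * q) (m + m') = Poly_Mapping.lookup p m * Poly_Mapping.lookup q m'"
proof -
  show "keys_le (p * q) (m + m')"
    using keys_mult[of p q] assms by (force simp: keys_le_def intro: add_mono)
  define P where "P m = Poly_Mapping.single m (Poly_Mapping.lookup p m)" for m
  define Q where "Q m = Poly_Mapping.single m (Poly_Mapping.lookup q m)" for m
  have p: "p = sum P (Poly_Mapping.keys p)" and q: "q = sum Q (Poly_Mapping.keys q)"
    unfolding P_def Q_def by (rule mpoly_eq_sum_monomials)+
  have eq: "a + b = m + m' \<longleftrightarrow> a = m \<and> b = m'"
    if "a \<in> Poly_Mapping.keys p" "b \<in> Poly_Mapping.keys q" for a b
  proof
    assume *: "a + b = m + m'"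
    have le: "a \<le> m" "b \<le> m'" using that assms by (auto simp: keys_le_def)
    have "a = m"
    proof (rule ccontr)
      assume "a \<noteq> m"
      then have "a + b < m + m'" using le by (intro add_less_le_mono) auto
      with * show False by simp
    qed
    with * show "a = m \<and> b = m'" by simp
  qed auto
  have "Poly_Mapping.lookup (p * q) (m + m')
     = Poly_Mapping.lookup (sum P (Poly_Mapping.keys p) * sum Q (Poly_Mapping.keys q)) (m + m')"
    using p q by simp
  also have "\<dots> = (\<Sum>a\<in>Poly_Mapping.keys p. \<Sum>b\<in>Poly_Mapping.keys q.
      if a + b = m + m' then Poly_Mapping.lookup p a * Poly_Mapping.lookup q b else 0)"
    unfolding sum_product lookup_sum by (simp add: P_def Q_def mult_single lookup_single when_def)
  also have "\<dots> = (\<Sum>a\<in>Poly_Mapping.keys p. \<Sum>b\<in>Poly_Mapping.keys q.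
      if a = m then if b = m' then Poly_Mapping.lookup p a * Poly_Mapping.lookup q b else 0 else 0)"
    by (intro sum.cong refl) (simp add: eq)
  also have "\<dots> = (\<Sum>a\<in>Poly_Mapping.keys p. if a = m then (\<Sum>b\<in>Poly_Mapping.keys q.
      if b = m' then Poly_Mapping.lookup p a * Poly_Mapping.lookup q b else 0) else 0)"
    by (intro sum.cong refl) simp
  also have "\<dots> = Poly_Mapping.lookup p m * Poly_Mapping.lookup q m'"
    by (simp add: sum.delta in_keys_iff)
  finally show "Poly_Mapping.lookup (p * q) (m + m') = Poly_Mapping.lookup p m * Poly_Mapping.lookup q m'" .
qed

lemma congruence_nth:
  "(A ** M ** transpose B) $ a $ b = (\<Sum>i\<in>UNIV. \<Sum>j\<in>UNIV. A $ a $ i * M $ i $ j * B $ b $ j)"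
  by (simp add: matrix_matrix_mult_def transpose_def sum_distrib_right) (rule sum.swap)

lemma int_mat_to_nth [simp]: "int_mat_to A $ i $ j = of_int (A $ i $ j)"
  by (simp add: int_mat_to_def)

lemma keys_le_euler: "keys_le p m \<Longrightarrow> keys_le (euler i p) m"
  by (auto simp: keys_le_def in_keys_iff lookup_euler)

lemma keys_le_diff:
  "keys_le p m \<Longrightarrow> keys_le q m \<Longrightarrow> keys_le (p - q) m" for p :: "('n::linorder, 'k::ab_group_add) mpoly"
  by (force simp: keys_le_def in_keys_iff lookup_minus)

lemma keys_le_exists:
  fixes p :: "('n::linorder, 'k::zero) mpoly"
  assumes "p \<noteq> 0" obtains m where "keys_le p m" "Poly_Mapping.lookup p m \<noteq> 0"
proof
  have ne: "Poly_Mapping.keys p \<noteq> {}" using assms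
    by (metis lookup_eq_zero_in_keys_contradict lookup_zero poly_mapping_eqI all_not_in_conv in_keys_iff)
  show "keys_le p (Max (Poly_Mapping.keys p))" by (simp add: keys_le_def)
  show "Poly_Mapping.lookup p (Max (Poly_Mapping.keys p)) \<noteq> 0"
    using Max_in[OF finite_keys ne] by (simp add: in_keys_iff)
qed

text \<open>The rows of the matrix are the differences of leading exponents of numerator and denominator;
  the matrix identity is the comparison of leading coefficients in the bracket relations.\<close>
lemma pbracket_multiplicative_imp_congruent:
  fixes y :: "'n \<Rightarrow> ('n::{finite,linorder}, 'k::field) ratfun" and L M :: "('k^'n::{finite,linorder})^'n::{finite,linorder}"
  assumes nz: "\<And>i. y i \<noteq> 0"
    and br: "\<And>i j. pbracket M (y i) (y j) = rf_const (L $ i $ j) * y i * y j"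
  shows "\<exists>B :: int^'n::{finite,linorder}^'n::{finite,linorder}. L = int_mat_to B ** M ** transpose (int_mat_to B)"
proof -
  have "\<exists>p q. q \<noteq> 0 \<and> y a = rf_poly p / rf_poly q" for a
    by (rule ratfun_cases[of "y a"]) blast
  then obtain P Q where Q: "\<And>a. Q a \<noteq> 0" and y: "\<And>a. y a = rf_poly (P a) / rf_poly (Q a)"
    by metis
  have P: "P a \<noteq> 0" for a using nz[of a] by (auto simp: y rf_poly_simps)
  have "\<exists>m. keys_le (P a) m \<and> Poly_Mapping.lookup (P a) m \<noteq> 0"
       "\<exists>m. keys_le (Q a) m \<and> Poly_Mapping.lookup (Q a) m \<noteq> 0" for a
    using keys_le_exists P Q by metis+
  then obtain m n where m: "\<And>a. keys_le (P a) (m a)" "\<And>a. Poly_Mapping.lookup (P a) (m a) \<noteq> 0"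
    and n: "\<And>a. keys_le (Q a) (n a)" "\<And>a. Poly_Mapping.lookup (Q a) (n a) \<noteq> 0"
    by metis
  define B :: "int^'n::{finite,linorder}^'n::{finite,linorder}" where
    "B = (\<chi> a i. int (Poly_Mapping.lookup (m a) i) - int (Poly_Mapping.lookup (n a) i))"
  \<comment> \<open>\<open>W a i\<close> is the numerator of the \<open>i\<close>-th Euler
    derivative of \<open>y a\<close> over the denominator \<open>Q a * Q a\<close>. Its coefficient
    at \<open>m a + n a\<close> is a multiple of \<open>t a\<close>, possibly zero.\<close>
  define W where "W a i = euler i (P a) * Q a - P a * euler i (Q a)" for a i
  define t where "t a = Poly_Mapping.lookup (P a) (m a) * Poly_Mapping.lookup (Q a) (n a)" for a
  have t: "t a \<noteq> 0" for a using m n by (simp add: t_def)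
  have W_top: "keys_le (W a i) (m a + n a)" for a i
    unfolding W_def by (intro keys_le_diff keys_le_mult keys_le_euler m n)
  have W_lookup: "Poly_Mapping.lookup (W a i) (m a + n a) = of_int (B $ a $ i) * t a" for a i
    unfolding W_def lookup_minus
    unfolding keys_le_mult(2)[OF keys_le_euler[OF m(1)] n(1)] keys_le_mult(2)[OF m(1) keys_le_euler[OF n(1)]] lookup_euler
    by (simp add: B_def t_def algebra_simps)
  have "L $ a $ b = (\<Sum>i\<in>UNIV. \<Sum>j\<in>UNIV. M $ i $ j * of_int (B $ a $ i) * of_int (B $ b $ j))" for a b
  proof -
    have e: "rf_euler i (y a) = rf_poly (W a i) / (rf_poly (Q a) * rf_poly (Q a))" for a i
      unfolding W_def by (simp add: y rf_euler_divide Q rf_poly_simps)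
    have "(\<Sum>i\<in>UNIV. \<Sum>j\<in>UNIV. rf_const (M $ i $ j) * rf_poly (W a i) * rf_poly (W b j))
       = (\<Sum>i\<in>UNIV. \<Sum>j\<in>UNIV. rf_const (M $ i $ j) * rf_euler i (y a) * rf_euler j (y b)) *
          (rf_poly (Q a) * rf_poly (Q a) * rf_poly (Q b) * rf_poly (Q b))"
      unfolding sum_distrib_right e
      by (intro sum.cong refl) (simp add: Q rf_poly_simps field_simps)
    also have "\<dots> = rf_const (L $ a $ b) * y a * y b * (rf_poly (Q a) * rf_poly (Q a) * rf_poly (Q b) * rf_poly (Q b))"
      using br[of a b] by (simp add: pbracket_euler)
    also have "\<dots> = rf_const (L $ a $ b) * (rf_poly (P a) * rf_poly (Q a)) * (rf_poly (P b) * rf_poly (Q b))"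
      by (simp add: y Q rf_poly_simps field_simps)
    finally have "rf_poly (\<Sum>i\<in>UNIV. \<Sum>j\<in>UNIV. Poly_Mapping.single 0 (M $ i $ j) * (W a i * W b j))
      = rf_poly (Poly_Mapping.single 0 (L $ a $ b) * ((P a * Q a) * (P b * Q b)))"
      by (simp add: rf_poly_sum rf_poly_simps rf_const_eq mult.assoc)
    then have eq: "(\<Sum>i\<in>UNIV. \<Sum>j\<in>UNIV. Poly_Mapping.single 0 (M $ i $ j) * (W a i * W b j))
      = Poly_Mapping.single 0 (L $ a $ b) * ((P a * Q a) * (P b * Q b))"
      by (simp only: rf_poly_simps(7))
    \<comment> \<open>All products in the cleared identity are bounded by \<open>w\<close>; reading
      off the coefficient there leaves the common nonzero factor \<open>t a * t b\<close>.\<close>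
    define w where "w = (m a + n a) + (m b + n b)"
    have sc: "Poly_Mapping.lookup (Poly_Mapping.single 0 c * p) k = c * Poly_Mapping.lookup p k"
      for c :: 'k and p :: "('n, 'k) mpoly" and k
      by (simp add: mult_map_scale_conv_mult[symmetric] map.rep_eq when_def)
    have "Poly_Mapping.lookup (W a i * W b j) w = (of_int (B $ a $ i) * t a) * (of_int (B $ b $ j) * t b)" for i j
      unfolding w_def by (simp add: keys_le_mult W_top W_lookup)
    moreover have "Poly_Mapping.lookup ((P a * Q a) * (P b * Q b)) w = t a * t b"
      unfolding w_def by (simp add: keys_le_mult m n t_def)
    ultimately have e1: "(\<Sum>i\<in>UNIV. \<Sum>j\<in>UNIV. M $ i $ j * ((of_int (B $ a $ i) * t a) * (of_int (B $ b $ j) * t b)))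
       = L $ a $ b * (t a * t b)"
      using arg_cong[OF eq, of "\<lambda>p. Poly_Mapping.lookup p w"] by (simp add: lookup_sum sc)
    have e2: "(\<Sum>i\<in>UNIV. \<Sum>j\<in>UNIV. M $ i $ j * of_int (B $ a $ i) * of_int (B $ b $ j)) * (t a * t b)
       = (\<Sum>i\<in>UNIV. \<Sum>j\<in>UNIV. M $ i $ j * ((of_int (B $ a $ i) * t a) * (of_int (B $ b $ j) * t b)))"
      unfolding sum_distrib_right by (intro sum.cong refl) (simp only: mult_ac)
    have "t a * t b \<noteq> 0" using t by simp
    with trans[OF e2 e1] show ?thesis by (simp only: mult_right_cancel simp_thms)
  qed
  then have "L = int_mat_to B ** M ** transpose (int_mat_to B)"
    by (simp add: vec_eq_iff congruence_nth mult.commute[of "M $ _ $ _"])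
  then show ?thesis by blast
qed

section \<open>Monomial substitutions\<close>

text \<open>The universal property of the field of fractions: trivial kernel keeps denominators
  nonzero, and cross-multiplication makes the value independent of the representative.\<close>

lemma fract_extension:
  fixes h :: "'a::idom \<Rightarrow> 'b::field"
  assumes add: "\<And>p q. h (p + q) = h p + h q" and mult: "\<And>p q. h (p * q) = h p * h q"
    and one: "h 1 = 1" and inj: "\<And>p. h p = 0 \<Longrightarrow> p = 0"
  obtains \<phi> where "\<And>p q. q \<noteq> 0 \<Longrightarrow> \<phi> (Fract p q) = h p / h q"
    "\<And>F G. \<phi> (F + G) = \<phi> F + \<phi> G" "\<And>F G. \<phi> (F * G) = \<phi> F * \<phi> G" "\<phi> 1 = 1"
proof -
  have "\<exists>y. \<forall>p q. q \<noteq> 0 \<longrightarrow> F = Fract p q \<longrightarrow> y = h p / h q" for F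
  proof (cases F)
    case (Fract a b)
    have "h a / h b = h p / h q" if "q \<noteq> 0" "F = Fract p q" for p q
    proof -
      have "a * q = p * b" using that Fract by (simp add: eq_fract)
      then have "h a * h q = h p * h b" by (metis mult)
      moreover have "h q \<noteq> 0" "h b \<noteq> 0" using inj that Fract by auto
      ultimately show ?thesis by (simp add: frac_eq_eq)
    qed
    then show ?thesis by blast
  qed
  then obtain \<phi> where \<phi>: "\<And>p q. q \<noteq> 0 \<Longrightarrow> \<phi> (Fract p q) = h p / h q" by metis
  have hnz: "h q \<noteq> 0" if "q \<noteq> 0" for q using inj that by blast
  show thesis
  proof
    show "\<phi> (Fract p q) = h p / h q" if "q \<noteq> 0" for p q using \<phi> that .
    show "\<phi> (F + G) = \<phi> F + \<phi> G" for F G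
    proof (cases F; cases G)
      fix a b c d assume "F = Fract a b" "b \<noteq> 0" "G = Fract c d" "d \<noteq> 0"
      then show ?thesis by (simp add: \<phi> add mult hnz add_frac_eq)
    qed
    show "\<phi> (F * G) = \<phi> F * \<phi> G" for F G
    proof (cases F; cases G)
      fix a b c d assume "F = Fract a b" "b \<noteq> 0" "G = Fract c d" "d \<noteq> 0"
      then show ?thesis by (simp add: \<phi> mult hnz)
    qed
    show "\<phi> 1 = 1" using \<phi>[of 1 1] by (simp add: one One_fract_def)
  qed
qed

definition laurent_mon :: "('n \<Rightarrow> int) \<Rightarrow> ('n::{finite,linorder}, 'k::field) ratfun" where
  "laurent_mon v = (\<Prod>j\<in>UNIV. rf_var j powi v j)"

lemma laurent_mon_add: "laurent_mon (\<lambda>j. v j + w j) = laurent_mon v * laurent_mon w"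
  by (simp add: laurent_mon_def power_int_add rf_var_nonzero prod.distrib)

lemma laurent_mon_0: "laurent_mon (\<lambda>j. 0) = 1"
  by (simp add: laurent_mon_def)

lemma laurent_mon_sum: "laurent_mon (\<lambda>j. \<Sum>i\<in>A. v i j) = (\<Prod>i\<in>A. laurent_mon (v i))"
  by (induction A rule: infinite_finite_induct) (simp_all add: laurent_mon_0 laurent_mon_add)

lemma laurent_mon_scale: "laurent_mon (\<lambda>j. n * v j) = laurent_mon v powi n"
proof -
  have "(\<Prod>j\<in>A. rf_var j powi (n * v j)) = (\<Prod>j\<in>A. rf_var j powi v j) powi n" for A
    by (induction A rule: infinite_finite_induct)
      (simp_all add: power_int_mult_distrib power_int_mult mult.commute[of n])
  then show ?thesis by (simp add: laurent_mon_def)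
qed

lemma rf_poly_single:
  "rf_poly (Poly_Mapping.single m c) = rf_const c * laurent_mon (\<lambda>j. int (Poly_Mapping.lookup m j))"
proof -
  have pow: "rf_poly (Poly_Mapping.single (Poly_Mapping.single j k) 1) = (rf_var j ^ k :: ('a, 'b) ratfun)" for j k
  proof (induction k)
    case (Suc k)
    have "Poly_Mapping.single (Poly_Mapping.single j (Suc k)) (1::'b)
       = Poly_Mapping.single (Poly_Mapping.single j 1) 1 * Poly_Mapping.single (Poly_Mapping.single j k) 1"
      by (simp add: mult_single single_add[symmetric])
    then show ?case by (simp only: rf_poly_simps Suc.IH rf_var_eq[symmetric] power_Suc)
  qed (simp add: rf_poly_simps)
  have prod: "(\<Prod>j\<in>A. rf_var j ^ f j) =
      (rf_poly (Poly_Mapping.single (\<Sum>j\<in>A. Poly_Mapping.single j (f j)) 1) :: ('a, 'b) ratfun)" for A f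
    by (induction A rule: infinite_finite_induct)
      (simp_all add: rf_poly_simps pow[symmetric] rf_poly_simps(3)[symmetric] mult_single)
  have "(\<Sum>j\<in>UNIV. Poly_Mapping.single j (Poly_Mapping.lookup m j)) = m"
    by (rule poly_mapping_eqI) (simp add: lookup_sum lookup_single when_def)
  then have "laurent_mon (\<lambda>j. int (Poly_Mapping.lookup m j)) = (rf_poly (Poly_Mapping.single m 1) :: ('a, 'b) ratfun)"
    using prod[of "Poly_Mapping.lookup m" UNIV] by (simp add: laurent_mon_def)
  then show ?thesis
    by (simp add: rf_const_eq rf_poly_simps(3)[symmetric] mult_single)
qed

lemma rf_euler_0: "rf_euler i 0 = 0"
  using rf_euler_const[of i 0] by (simp add: rf_const_simps)

lemma rf_euler_1: "rf_euler i 1 = 0"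
  using rf_euler_const[of i 1] by (simp add: rf_const_simps)

lemma rf_euler_sum: "rf_euler i (sum f A) = (\<Sum>a\<in>A. rf_euler i (f a))"
  by (induction A rule: infinite_finite_induct) (simp_all add: rf_euler_0 rf_euler_add)

lemma rf_euler_power: "rf_euler i F = of_int c * F \<Longrightarrow> rf_euler i (F ^ k) = of_int (int k * c) * F ^ k"
  by (induction k) (simp_all add: rf_euler_1 rf_euler_mult algebra_simps)

lemma rf_euler_inverse: "F \<noteq> 0 \<Longrightarrow> rf_euler i F = of_int c * F \<Longrightarrow> rf_euler i (inverse F) = of_int (- c) * inverse F"
proof -
  assume F: "F \<noteq> 0" "rf_euler i F = of_int c * F"
  have "0 = rf_euler i (F * inverse F)" using F by (simp add: rf_euler_1)
  also have "\<dots> = of_int c + F * rf_euler i (inverse F)"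
    unfolding rf_euler_mult using F by simp
  finally show ?thesis using F by (simp add: field_simps eq_neg_iff_add_eq_0)
qed

lemma rf_euler_power_int:
  assumes "F \<noteq> 0" "rf_euler i F = of_int c * F"
  shows "rf_euler i (F powi k) = of_int (k * c) * F powi k"
proof (cases "k \<ge> 0")
  case True
  then show ?thesis using rf_euler_power[OF assms(2), of "nat k"] by (simp add: power_int_def)
next
  case False
  then show ?thesis using rf_euler_power[OF rf_euler_inverse[OF assms], of "nat (- k)"]
    by (simp add: power_int_def)
qed

lemma rf_euler_prod:
  assumes "\<And>a. a \<in> A \<Longrightarrow> rf_euler i (f a) = of_int (c a) * f a"
  shows "rf_euler i (prod f A) = of_int (sum c A) * prod f A"
  using assms
  by (induction A rule: infinite_finite_induct) (simp_all add: rf_euler_1 rf_euler_mult algebra_simps)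

text \<open>Eigenvalues of a derivation add under products and change sign under inversion, so
  Laurent monomials are common eigenvectors of the Euler derivations.\<close>

lemma rf_euler_laurent_mon: "rf_euler i (laurent_mon v) = of_int (v i) * laurent_mon v"
proof -
  have "rf_euler i (rf_var j powi v j) = of_int (v j * (if i = j then 1 else 0)) * rf_var j powi v j" for j
    by (rule rf_euler_power_int) (simp_all add: rf_var_nonzero rf_euler_var)
  then have "rf_euler i (laurent_mon v) = of_int (\<Sum>j\<in>UNIV. v j * (if i = j then 1 else 0)) * laurent_mon v"
    unfolding laurent_mon_def by (rule rf_euler_prod)
  then show ?thesis by (simp add: if_distrib[of "\<lambda>z. _ * z"] cong: if_cong)
qed

text \<open>The row vector \<open>v\<close> times \<open>B\<close>: the effect on exponents when
  each variable is replaced by the monomial whose exponents are the corresponding row of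
  \<open>B\<close>.\<close>

definition row_comb :: "int^'n^'n \<Rightarrow> ('n \<Rightarrow> int) \<Rightarrow> 'n \<Rightarrow> int" where
  "row_comb B v = (\<lambda>j. \<Sum>i\<in>UNIV. v i * B $ i $ j)"

lemma row_comb_mult: "row_comb C (row_comb B v) = row_comb (B ** C) v"
  unfolding row_comb_def matrix_matrix_mult_def
  by (rule ext) (simp add: sum_distrib_left sum_distrib_right mult.assoc, subst sum.swap, simp)

lemma row_comb_mat_1: "row_comb (mat 1) v = v"
  by (rule ext) (simp add: row_comb_def mat_def if_distrib[of "\<lambda>z. _ * z"] cong: if_cong)

text \<open>The values lie in the function field, since \<open>B\<close> may have negative
  entries.\<close>

definition mon_subst :: "int^'n::{finite,linorder}^'n::{finite,linorder} \<Rightarrow> ('n::{finite,linorder}, 'k::field) mpoly \<Rightarrow> ('n, 'k) ratfun" where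
  "mon_subst B p = (\<Sum>m\<in>Poly_Mapping.keys p. rf_const (Poly_Mapping.lookup p m) *
     laurent_mon (row_comb B (\<lambda>i. int (Poly_Mapping.lookup m i))))"

lemma mon_subst_add: "mon_subst B (p + q) = mon_subst B p + mon_subst B q"
  unfolding mon_subst_def
  by (rule setsum_keys_plus_distrib) (simp_all add: rf_const_simps algebra_simps)

lemma mon_subst_0: "mon_subst B 0 = 0"
  by (simp add: mon_subst_def)

lemma mon_subst_single: "mon_subst B (Poly_Mapping.single m c) =
    rf_const c * laurent_mon (row_comb B (\<lambda>i. int (Poly_Mapping.lookup m i)))"
  by (simp add: mon_subst_def rf_const_simps)

lemma mon_subst_sum: "mon_subst B (sum f A) = (\<Sum>a\<in>A. mon_subst B (f a))"
  by (induction A rule: infinite_finite_induct) (simp_all add: mon_subst_0 mon_subst_add)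

lemma mon_subst_mult: "mon_subst B (p * q) = mon_subst B p * mon_subst B q"
proof -
  have mono: "mon_subst B (Poly_Mapping.single m c * Poly_Mapping.single m' c')
     = mon_subst B (Poly_Mapping.single m c) * mon_subst B (Poly_Mapping.single m' c')" for m m' c c'
    by (simp add: mult_single mon_subst_single rf_const_simps lookup_add laurent_mon_add[symmetric]
        row_comb_def distrib_right sum.distrib)
  define P where "P m = Poly_Mapping.single m (Poly_Mapping.lookup p m)" for m
  define Q where "Q m = Poly_Mapping.single m (Poly_Mapping.lookup q m)" for m
  have p: "p = sum P (Poly_Mapping.keys p)" and q: "q = sum Q (Poly_Mapping.keys q)"
    unfolding P_def Q_def by (rule mpoly_eq_sum_monomials)+
  have "mon_subst B (sum P X * sum Q Y) = mon_subst B (sum P X) * mon_subst B (sum Q Y)" for X Y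
    by (simp add: mon_subst_sum sum_product mono P_def Q_def)
  from this[of "Poly_Mapping.keys p" "Poly_Mapping.keys q"] show ?thesis
    by (simp add: p[symmetric] q[symmetric])
qed

lemma mon_subst_1: "mon_subst B 1 = 1"
  using mon_subst_single[of B 0 1] by (simp add: rf_const_simps row_comb_def laurent_mon_0)

text \<open>After clearing negative exponents with the monomial \<open>N\<close>, the distinct monomials of \<open>p\<close>
  still have distinct images, so nothing can cancel.\<close>
lemma mon_subst_eq_0:
  fixes p :: "('n::{finite,linorder}, 'k::field) mpoly"
  assumes BC: "B ** C = mat 1" and 0: "mon_subst B p = 0"
  shows "p = 0"
proof (rule poly_mapping_eqI)
  fix m0
  define v where "v m = row_comb B (\<lambda>i. int (Poly_Mapping.lookup m i))" for m :: "'n \<Rightarrow>\<^sub>0 nat"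
  define N where "N j = (\<Sum>m\<in>Poly_Mapping.keys p. \<bar>v m j\<bar>)" for j
  define w where "w m = Abs_poly_mapping (\<lambda>j. nat (v m j + N j))" for m
  have lw: "Poly_Mapping.lookup (w m) j = nat (v m j + N j)" for m j
    by (simp add: w_def)
  have ge: "v m j + N j \<ge> 0" if "m \<in> Poly_Mapping.keys p" for m j
  proof -
    have "\<bar>v m j\<bar> \<le> N j" unfolding N_def by (rule member_le_sum) (use that in auto)
    then show ?thesis by linarith
  qed
  have inj: "m = m'" if "w m = w m'" "m \<in> Poly_Mapping.keys p" "m' \<in> Poly_Mapping.keys p" for m m'
  proof -
    have "v m = v m'"
    proof
      fix j
      show "v m j = v m' j"
        using arg_cong[OF that(1), of "\<lambda>x. Poly_Mapping.lookup x j"] ge[OF that(2), of j] ge[OF that(3), of j]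
        by (simp add: lw eq_nat_nat_iff)
    qed
    \<comment> \<open>Because \<open>B ** C = mat 1\<close>, the matrix \<open>C\<close> recovers an
      exponent vector from its image.\<close>
    then have "row_comb C (v m) = row_comb C (v m')" by simp
    then show ?thesis by (simp add: v_def row_comb_mult BC row_comb_mat_1 fun_eq_iff poly_mapping_eqI)
  qed
  have "0 = mon_subst B p * laurent_mon N" using 0 by simp
  also have "\<dots> = (\<Sum>m\<in>Poly_Mapping.keys p. rf_const (Poly_Mapping.lookup p m) *
       laurent_mon (\<lambda>j. int (Poly_Mapping.lookup (w m) j)))"
    unfolding mon_subst_def sum_distrib_right v_def[symmetric] mult.assoc laurent_mon_add[symmetric]
    by (intro sum.cong refl arg_cong2[of _ _ _ _ "(*)"] arg_cong[of _ _ laurent_mon]) (simp add: lw ge)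
  also have "\<dots> = rf_poly (\<Sum>m\<in>Poly_Mapping.keys p. Poly_Mapping.single (w m) (Poly_Mapping.lookup p m))"
    by (simp add: rf_poly_sum rf_poly_single)
  finally have s0: "(\<Sum>m\<in>Poly_Mapping.keys p. Poly_Mapping.single (w m) (Poly_Mapping.lookup p m)) = 0"
    by (metis rf_poly_simps(6))
  have z: "(\<Sum>m\<in>Poly_Mapping.keys p. if w m = w m0 then Poly_Mapping.lookup p m else 0) = 0"
    using arg_cong[OF s0, of "\<lambda>q. Poly_Mapping.lookup q (w m0)"]
    by (simp add: lookup_sum lookup_single when_def)
  show "Poly_Mapping.lookup p m0 = Poly_Mapping.lookup 0 m0"
  proof (cases "m0 \<in> Poly_Mapping.keys p")
    case True
    have "(\<Sum>m\<in>Poly_Mapping.keys p. if w m = w m0 then Poly_Mapping.lookup p m else 0)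
        = (\<Sum>m\<in>Poly_Mapping.keys p. if m = m0 then Poly_Mapping.lookup p m else 0)"
      by (intro sum.cong refl) (use inj True in auto)
    then show ?thesis using z True by simp
  qed (simp add: in_keys_iff)
qed

text \<open>The chain rule. On a monomial both sides multiply its image by the \<open>j\<close>-th
  entry of the transformed exponent vector.\<close>

lemma rf_euler_mon_subst:
  fixes p :: "('n::{finite,linorder}, 'k::field) mpoly"
  shows "rf_euler j (mon_subst B p) = (\<Sum>i\<in>UNIV. of_int (B $ i $ j) * mon_subst B (euler i p))"
proof -
  have mono: "rf_euler j (mon_subst B (Poly_Mapping.single m c)) =
     (\<Sum>i\<in>UNIV. of_int (B $ i $ j) * mon_subst B (euler i (Poly_Mapping.single m c)))" for m and c :: 'k
    by (simp add: mon_subst_single euler_single rf_euler_mult rf_euler_const rf_euler_laurent_mon rf_const_simps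
        rf_const_of_nat row_comb_def sum_distrib_right sum_distrib_left mult_ac)
  define P where "P m = Poly_Mapping.single m (Poly_Mapping.lookup p m)" for m
  have p: "p = sum P (Poly_Mapping.keys p)"
    unfolding P_def by (rule mpoly_eq_sum_monomials)+
  have "rf_euler j (mon_subst B (sum P X)) = (\<Sum>i\<in>UNIV. of_int (B $ i $ j) * mon_subst B (euler i (sum P X)))" for X
    by (simp add: mon_subst_sum rf_euler_sum euler_sum P_def mono sum_distrib_left sum.swap[of _ X])
  from this[of "Poly_Mapping.keys p"] show ?thesis by (simp add: p[symmetric])
qed

text \<open>Collects what is needed of the endomorphism of the function field acting on Laurent
  monomials through \<open>B\<close>; the last conjunct is the chain rule.\<close>

definition monomial_hom ::
  "int^'n::{finite,linorder}^'n::{finite,linorder} \<Rightarrow> (('n, 'k::field) ratfun \<Rightarrow> ('n, 'k) ratfun) \<Rightarrow> bool" where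
  "monomial_hom B \<phi> \<longleftrightarrow>
    (\<forall>F G. \<phi> (F + G) = \<phi> F + \<phi> G) \<and> (\<forall>F G. \<phi> (F * G) = \<phi> F * \<phi> G) \<and> \<phi> 1 = 1 \<and>
    (\<forall>c. \<phi> (rf_const c) = rf_const c) \<and>
    (\<forall>v. \<phi> (laurent_mon v) = laurent_mon (row_comb B v)) \<and>
    (\<forall>j F. rf_euler j (\<phi> F) = (\<Sum>i\<in>UNIV. of_int (B $ i $ j) * \<phi> (rf_euler i F)))"

text \<open>The right inverse \<open>C\<close> makes \<open>mon_subst B\<close> injective, so it
  extends to the field of fractions.\<close>

lemma monomial_hom_exists:
  fixes B C :: "int^'n::{finite,linorder}^'n::{finite,linorder}"
  assumes BC: "B ** C = mat 1"
  shows "\<exists>\<phi> :: ('n, 'k::field) ratfun \<Rightarrow> ('n, 'k) ratfun. monomial_hom B \<phi>"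
proof -
  obtain \<phi> :: "('n, 'k) ratfun \<Rightarrow> ('n, 'k) ratfun" where
    Fr: "\<And>p q. q \<noteq> 0 \<Longrightarrow> \<phi> (Fract p q) = mon_subst B p / mon_subst B q"
    and add: "\<And>F G. \<phi> (F + G) = \<phi> F + \<phi> G" and mult: "\<And>F G. \<phi> (F * G) = \<phi> F * \<phi> G"
    and one: "\<phi> 1 = 1"
    by (rule fract_extension[of "mon_subst B"])
      (use mon_subst_add mon_subst_mult mon_subst_1 mon_subst_eq_0[OF BC] in blast)+
  have poly: "\<phi> (rf_poly p) = mon_subst B p" for p
    using Fr[of 1 p] by (simp add: rf_poly_def mon_subst_1)
  have nz: "mon_subst B q \<noteq> 0" if "q \<noteq> 0" for q :: "('n, 'k) mpoly"
    using mon_subst_eq_0[OF BC] that by blast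
  have Fr': "\<phi> (rf_poly p / rf_poly q) = mon_subst B p / mon_subst B q" if "q \<noteq> 0" for p q
    using Fr[OF that] by (simp add: Fract_eq_divide)
  have prod: "\<phi> (prod f A) = (\<Prod>a\<in>A. \<phi> (f a))" for f :: "'n \<Rightarrow> _" and A
    by (induction A rule: infinite_finite_induct) (simp_all add: one mult)
  have power: "\<phi> (F ^ k) = \<phi> F ^ k" for F k
    by (induction k) (simp_all add: one mult)
  have zero: "\<phi> 0 = 0" using add[of 0 0] by (simp only: add_0_right add_cancel_right_right)
  have inv: "\<phi> (inverse F) = inverse (\<phi> F)" for F
  proof (cases "F = 0")
    case False
    then have "\<phi> F * \<phi> (inverse F) = 1" by (simp add: mult[symmetric] one)
    then show ?thesis by (simp add: inverse_unique)
  qed (simp add: zero)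
  have powi: "\<phi> (F powi k) = \<phi> F powi k" for F k
    by (simp add: power_int_def power inv)
  have const: "\<phi> (rf_const c) = rf_const c" for c
    by (simp add: rf_const_eq poly mon_subst_single row_comb_def laurent_mon_0)
  have var: "\<phi> (rf_var i) = laurent_mon (\<lambda>j. B $ i $ j)" for i
    unfolding rf_var_eq poly mon_subst_single
    by (simp add: rf_const_simps row_comb_def lookup_single when_def if_distrib[of int]
        if_distrib[of "\<lambda>z. z * _"] cong: if_cong)
  have mon: "\<phi> (laurent_mon v) = laurent_mon (row_comb B v)" for v
    unfolding row_comb_def laurent_mon_sum laurent_mon_scale
    by (simp add: laurent_mon_def[of v] prod powi var)
  \<comment> \<open>For \<open>F = p / q\<close>, the derivative of the image of
    \<open>q * F = p\<close> is computed directly in \<open>e1\<close> and through the chain rule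
    for polynomials in \<open>e2\<close>; cancelling the image of \<open>q\<close> compares the
    two.\<close>
  have euler: "rf_euler j (\<phi> F) = (\<Sum>i\<in>UNIV. of_int (B $ i $ j) * \<phi> (rf_euler i F))" for j F
  proof (rule ratfun_cases[of F])
    fix p q :: "('n, 'k) mpoly"
    assume q: "q \<noteq> 0" and F: "F = rf_poly p / rf_poly q"
    let ?h = "mon_subst B"
    have "?h q * \<phi> F = ?h p" by (simp add: F Fr' q nz)
    then have e1: "rf_euler j (?h q) * \<phi> F + ?h q * rf_euler j (\<phi> F) = rf_euler j (?h p)"
      by (metis rf_euler_mult)
    have e2: "rf_euler j (?h q) * \<phi> F + ?h q * (\<Sum>i\<in>UNIV. of_int (B $ i $ j) * \<phi> (rf_euler i F)) = rf_euler j (?h p)"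
    proof -
      have *: "?h (euler i q) * \<phi> F + ?h q * \<phi> (rf_euler i F) = ?h (euler i p)" for i
      proof -
        have "rf_poly q * F = rf_poly p" using q by (simp add: F rf_poly_simps)
        then have "rf_poly (euler i q) * F + rf_poly q * rf_euler i F = rf_poly (euler i p)"
          by (metis rf_euler_mult rf_euler_rf_poly)
        from arg_cong[OF this, of \<phi>] show ?thesis by (simp add: add mult poly)
      qed
      show ?thesis
        unfolding rf_euler_mon_subst *[symmetric] sum_distrib_left sum_distrib_right sum.distrib[symmetric]
        by (intro sum.cong refl) (simp only: distrib_left mult_ac)
    qed
    from trans[OF e1 e2[symmetric]] have "?h q * rf_euler j (\<phi> F) = ?h q * (\<Sum>i\<in>UNIV. of_int (B $ i $ j) * \<phi> (rf_euler i F))"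
      by (simp only: add_left_cancel)
    then show ?thesis using nz[OF q] by simp
  qed
  show ?thesis using add mult one const mon euler unfolding monomial_hom_def by (intro exI[of _ \<phi>]) simp
qed

text \<open>The substitutions by \<open>B\<close> and \<open>C\<close> are mutually inverse, and the
  chain rule turns the bracket of \<open>M\<close> between images into the bracket of
  \<open>B ** M ** transpose B\<close>, read over the field.\<close>

lemma congruent_imp_poisson_isomorphic:
  fixes L M :: "('k::field^'n::{finite,linorder})^'n::{finite,linorder}"
    and B C :: "int^'n::{finite,linorder}^'n::{finite,linorder}"
  assumes BC: "B ** C = mat 1" and CB: "C ** B = mat 1"
    and L: "L = int_mat_to B ** M ** transpose (int_mat_to B)"
  shows "poisson_isomorphic L M TYPE('n)"
proof -
  obtain \<phi> :: "('n, 'k) ratfun \<Rightarrow> ('n, 'k) ratfun" where \<phi>: "monomial_hom B \<phi>"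
    using monomial_hom_exists[OF BC] by blast
  obtain \<psi> :: "('n, 'k) ratfun \<Rightarrow> ('n, 'k) ratfun" where \<psi>: "monomial_hom C \<psi>"
    using monomial_hom_exists[OF CB] by blast
  have add: "\<And>F G. \<phi> (F + G) = \<phi> F + \<phi> G" and mult: "\<And>F G. \<phi> (F * G) = \<phi> F * \<phi> G" and one: "\<phi> 1 = 1"
    and const: "\<And>c. \<phi> (rf_const c) = rf_const c"
    and mon: "\<And>v. \<phi> (laurent_mon v) = laurent_mon (row_comb B v)"
    and euler: "\<And>j F. rf_euler j (\<phi> F) = (\<Sum>i\<in>UNIV. of_int (B $ i $ j) * \<phi> (rf_euler i F))"
    using \<phi> unfolding monomial_hom_def by blast+
  have add': "\<And>F G. \<psi> (F + G) = \<psi> F + \<psi> G" and mult': "\<And>F G. \<psi> (F * G) = \<psi> F * \<psi> G"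
    and const': "\<And>c. \<psi> (rf_const c) = rf_const c"
    and mon': "\<And>v. \<psi> (laurent_mon v) = laurent_mon (row_comb C v)"
    using \<psi> unfolding monomial_hom_def by blast+
  \<comment> \<open>Constants and Laurent monomials determine a ring endomorphism on polynomials,
    hence on quotients; this serves for both composites.\<close>
  have id: "\<theta> F = F" if add: "\<And>F G. \<theta> (F + G) = \<theta> F + \<theta> G" and mult: "\<And>F G. \<theta> (F * G) = \<theta> F * \<theta> G"
    and const: "\<And>c. \<theta> (rf_const c) = rf_const c" and mon: "\<And>v. \<theta> (laurent_mon v) = laurent_mon v"
    for \<theta> :: "('n, 'k) ratfun \<Rightarrow> ('n, 'k) ratfun" and F
  proof (rule ratfun_cases[of F])
    have zero: "\<theta> 0 = 0" using add[of 0 0] by (simp only: add_0_right add_cancel_right_right)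
    have sum: "\<theta> (sum f A) = (\<Sum>a\<in>A. \<theta> (f a))" for f :: "('n \<Rightarrow>\<^sub>0 nat) \<Rightarrow> _" and A
      by (induction A rule: infinite_finite_induct) (simp_all add: zero add)
    have poly: "\<theta> (rf_poly p) = rf_poly p" for p
    proof -
      have "rf_poly p = (\<Sum>m\<in>Poly_Mapping.keys p. rf_poly (Poly_Mapping.single m (Poly_Mapping.lookup p m)))"
        by (subst mpoly_eq_sum_monomials[of p]) (simp only: rf_poly_sum)
      then show ?thesis by (simp add: sum rf_poly_single mult const mon)
    qed
    fix p q :: "('n, 'k) mpoly"
    assume q: "q \<noteq> 0" and F: "F = rf_poly p / rf_poly q"
    then have qF: "rf_poly q * F = rf_poly p" by (simp add: rf_poly_simps)
    then have "rf_poly q * \<theta> F = rf_poly p" by (metis mult poly)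
    with qF have "rf_poly q * \<theta> F = rf_poly q * F" by simp
    then show "\<theta> F = F" using q by (simp add: rf_poly_simps)
  qed
  have "\<psi> (\<phi> F) = F" for F
    by (rule id) (simp_all add: add add' mult mult' const const' mon mon' row_comb_mult BC row_comb_mat_1)
  moreover have "\<phi> (\<psi> F) = F" for F
    by (rule id) (simp_all add: add add' mult mult' const const' mon mon' row_comb_mult CB row_comb_mat_1)
  ultimately have bij: "bij \<phi>" by (intro o_bij[of \<psi>]) (auto simp: fun_eq_iff)
  have L_eq: "L $ i $ i' = (\<Sum>j\<in>UNIV. \<Sum>l\<in>UNIV. M $ j $ l * of_int (B $ i $ j) * of_int (B $ i' $ l))" for i i'
    by (simp add: L congruence_nth mult.commute[of "M $ _ $ _"])
  have zero: "\<phi> 0 = 0" using add[of 0 0] by (simp only: add_0_right add_cancel_right_right)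
  have sum: "\<phi> (sum f A) = (\<Sum>a\<in>A. \<phi> (f a))" for f :: "'n \<Rightarrow> _" and A
    by (induction A rule: infinite_finite_induct) (simp_all add: zero add)
  have "\<phi> (pbracket L F G) = pbracket M (\<phi> F) (\<phi> G)" for F G
  proof -
    have prod_sums: "c * sum f UNIV * sum g UNIV = (\<Sum>i\<in>UNIV. \<Sum>i'\<in>UNIV. c * (f i * g i'))"
      for c and f g :: "'n \<Rightarrow> ('n, 'k) ratfun"
      unfolding mult.assoc by (subst sum_product) (simp add: sum_distrib_left)
    \<comment> \<open>The sums are reordered until those over \<open>j\<close> and \<open>l\<close>
      are innermost, where they add up to the entry of \<open>L\<close> at \<open>i\<close>,
      \<open>i'\<close>.\<close>
    have "pbracket M (\<phi> F) (\<phi> G) = (\<Sum>j\<in>UNIV. \<Sum>l\<in>UNIV. \<Sum>i\<in>UNIV. \<Sum>i'\<in>UNIV.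
        rf_const (M $ j $ l) * (of_int (B $ i $ j) * of_int (B $ i' $ l)) * (\<phi> (rf_euler i F) * \<phi> (rf_euler i' G)))"
      unfolding pbracket_euler euler prod_sums by (simp add: mult_ac)
    also have "\<dots> = (\<Sum>j\<in>UNIV. \<Sum>i\<in>UNIV. \<Sum>l\<in>UNIV. \<Sum>i'\<in>UNIV.
        rf_const (M $ j $ l) * (of_int (B $ i $ j) * of_int (B $ i' $ l)) * (\<phi> (rf_euler i F) * \<phi> (rf_euler i' G)))"
      by (intro sum.cong refl sum.swap)
    also have "\<dots> = (\<Sum>i\<in>UNIV. \<Sum>j\<in>UNIV. \<Sum>l\<in>UNIV. \<Sum>i'\<in>UNIV.
        rf_const (M $ j $ l) * (of_int (B $ i $ j) * of_int (B $ i' $ l)) * (\<phi> (rf_euler i F) * \<phi> (rf_euler i' G)))"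
      by (rule sum.swap)
    also have "\<dots> = (\<Sum>i\<in>UNIV. \<Sum>j\<in>UNIV. \<Sum>i'\<in>UNIV. \<Sum>l\<in>UNIV.
        rf_const (M $ j $ l) * (of_int (B $ i $ j) * of_int (B $ i' $ l)) * (\<phi> (rf_euler i F) * \<phi> (rf_euler i' G)))"
      by (intro sum.cong refl sum.swap)
    also have "\<dots> = (\<Sum>i\<in>UNIV. \<Sum>i'\<in>UNIV. \<Sum>j\<in>UNIV. \<Sum>l\<in>UNIV.
        rf_const (M $ j $ l) * (of_int (B $ i $ j) * of_int (B $ i' $ l)) * (\<phi> (rf_euler i F) * \<phi> (rf_euler i' G)))"
      by (intro sum.cong refl sum.swap)
    also have "\<dots> = (\<Sum>i\<in>UNIV. \<Sum>i'\<in>UNIV. rf_const (L $ i $ i') * (\<phi> (rf_euler i F) * \<phi> (rf_euler i' G)))"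
      by (simp add: L_eq rf_const_sum rf_const_simps rf_const_of_int sum_distrib_right mult.assoc)
    also have "\<dots> = \<phi> (pbracket L F G)"
      by (simp add: pbracket_euler sum mult const mult.assoc)
    finally show ?thesis by simp
  qed
  then have "poisson_iso L M \<phi>"
    unfolding poisson_iso_def using bij add mult one const by simp
  then show ?thesis unfolding poisson_isomorphic_def by blast
qed

section \<open>Integer matrices and unimodular congruence\<close>

lemma int_mat_to_mult: "int_mat_to (A ** B) = int_mat_to A ** int_mat_to B"
  by (simp add: vec_eq_iff matrix_matrix_mult_def)

lemma int_mat_to_transpose: "int_mat_to (transpose A) = transpose (int_mat_to A)"
  by (simp add: vec_eq_iff transpose_def)

lemma int_mat_to_mat_1: "int_mat_to (mat 1) = mat 1"
  by (simp add: vec_eq_iff mat_def)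

lemma int_mat_to_inject:
  "(int_mat_to A :: 'k::ring_char_0^'n^'m) = int_mat_to B \<longleftrightarrow> A = B"
  by (simp add: vec_eq_iff)

lemma det_int_mat_to: "det (int_mat_to A :: 'k::comm_ring_1^'n^'n) = of_int (det A)"
  by (simp add: det_def)

lemma congruence_trans:
  fixes A B X :: "'k::comm_semiring_1^'n^'n"
  shows "A ** (B ** X ** transpose B) ** transpose A = (A ** B) ** X ** transpose (A ** B)"
  by (simp add: matrix_transpose_mul matrix_mul_assoc)

text \<open>Over the rationals a one-sided inverse of a square matrix is two-sided, and the
  embedding of integer matrices is injective.\<close>

lemma int_left_right_inverse:
  fixes C D :: "int^'n^'n"
  assumes "C ** D = mat 1"
  shows "D ** C = mat 1"
proof -
  have "(int_mat_to C :: rat^'n^'n) ** int_mat_to D = mat 1"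
    by (simp add: int_mat_to_mult[symmetric] assms int_mat_to_mat_1)
  then have "(int_mat_to D :: rat^'n^'n) ** int_mat_to C = mat 1"
    by (rule matrix_left_right_inverse1)
  then show ?thesis
    by (metis int_mat_to_inject int_mat_to_mat_1 int_mat_to_mult)
qed

lemma int_invertible_iff_abs_det:
  fixes C :: "int^'n^'n"
  shows "invertible C \<longleftrightarrow> \<bar>det C\<bar> = 1"
proof
  assume "invertible C"
  then obtain D where "C ** D = mat 1" by (auto simp: invertible_def)
  then have "det C * det D = 1" by (metis det_mul det_I)
  then show "\<bar>det C\<bar> = 1" by (metis dvd_triv_left zdvd1_eq)
next
  assume *: "\<bar>det C\<bar> = 1"
  then have sq: "det C * det C = 1" by (metis abs_mult_self_eq mult_1)
  \<comment> \<open>\<open>N k l\<close> is \<open>C\<close> with column \<open>k\<close> replaced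
    by the \<open>l\<close>-th basis vector, so its determinant is an entry of the adjugate. As
    \<open>det C\<close> is its own inverse, Cramer's rule makes \<open>D\<close> the inverse of
    \<open>C\<close>.\<close>
  define N where "N k l = (\<chi> i j. if j = k then (if i = l then 1 else 0) else C $ i $ j)" for k l
  define D :: "int^'n^'n" where "D = (\<chi> k l. det (N k l) * det C)"
  let ?C = "int_mat_to C :: rat^'n^'n"
  have nz: "det ?C \<noteq> 0" using * by (auto simp: det_int_mat_to)
  have inv: "inverse (of_int (det C)) = (of_int (det C) :: rat)"
    by (rule inverse_unique) (metis sq of_int_1 of_int_mult)
  have "?C ** int_mat_to D = mat 1"
  proof -
    have "?C *v (\<chi> k. of_int (D $ k $ l)) = axis l 1" for l
    proof -
      have N_eq: "(\<chi> i j. if j = k then (axis l 1 :: rat^'n) $ i else ?C $ i $ j) = int_mat_to (N k l)" for k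
        by (simp add: vec_eq_iff N_def axis_def)
      show ?thesis
        unfolding cramer[OF nz] N_eq det_int_mat_to by (simp add: vec_eq_iff D_def divide_inverse inv)
    qed
    then show ?thesis
      by (simp add: vec_eq_iff matrix_matrix_mult_def matrix_vector_mult_def axis_def mat_def)
  qed
  then have "C ** D = mat 1"
    by (metis int_mat_to_inject int_mat_to_mat_1 int_mat_to_mult)
  then show "invertible C" using int_left_right_inverse unfolding invertible_def by blast
qed

text \<open>Taking determinants and cancelling \<open>det X\<close> leaves the square of
  \<open>det C\<close> equal to 1.\<close>

lemma abs_det_eq_1_if_congruence_fixes:
  fixes C :: "int^'n^'n" and X :: "'k::field_char_0^'n^'n"
  assumes X: "det X \<noteq> 0" and fixed: "X = int_mat_to C ** X ** transpose (int_mat_to C)"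
  shows "\<bar>det C\<bar> = 1"
proof -
  have "det X = of_int (det C) * det X * of_int (det C)"
    using arg_cong[OF fixed, of det] by (simp add: det_mul det_int_mat_to)
  then have "of_int (det C * det C) = (1::'k)" using X by simp
  then have "det C * det C = 1" by (simp only: of_int_eq_1_iff)
  then show ?thesis by (metis dvd_triv_left zdvd1_eq)
qed

lemma int_invertible_factors:
  fixes A B :: "int^'n^'n"
  assumes "\<bar>det (B ** A)\<bar> = 1"
  shows "invertible A" "invertible B"
proof -
  have "\<bar>det B\<bar> * \<bar>det A\<bar> = 1" using assms by (simp add: det_mul abs_mult)
  then show "invertible A" "invertible B"
    by (simp_all add: int_invertible_iff_abs_det) (metis abs_idempotent dvd_triv_left dvd_triv_right zdvd1_eq)+
qed

section \<open>Integral null vectors and splitting off the radical\<close>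

lemma common_denominator:
  fixes f :: "'a \<Rightarrow> rat"
  assumes "finite S"
  shows "\<exists>d::int. d \<noteq> 0 \<and> (\<forall>i\<in>S. \<exists>z. of_int d * f i = of_int z)"
  using assms
proof (induction S rule: finite_induct)
  case (insert a S)
  then obtain d where d: "d \<noteq> 0" "\<And>i. i \<in> S \<Longrightarrow> \<exists>z. of_int d * f i = of_int z" by blast
  obtain p q where pq: "quotient_of (f a) = (p, q)" by force
  then have q: "q > 0" and fa: "f a = of_int p / of_int q"
    using quotient_of_denom_pos quotient_of_div by blast+
  have "of_int (d * q) * f a = of_int (d * p)" using q by (simp add: fa)
  then have "\<exists>z. of_int (d * q) * f a = of_int z" ..
  moreover have "\<exists>z. of_int (d * q) * f i = of_int z" if i: "i \<in> S" for i
  proof -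
    obtain z where "of_int d * f i = of_int z" using d(2)[OF i] by blast
    then have "of_int (d * q) * f i = of_int (q * z)" by (simp add: mult_ac)
    then show ?thesis ..
  qed
  ultimately have "\<forall>i\<in>insert a S. \<exists>z. of_int (d * q) * f i = of_int z" by blast
  moreover have "d * q \<noteq> 0" using d(1) q by simp
  ultimately show ?case by blast
qed (auto intro: exI[of _ 1])

text \<open>A rational null vector with its denominators cleared.\<close>

lemma int_det_0_kernel:
  fixes E :: "int^'n^'n"
  assumes "det E = 0"
  obtains v where "v \<noteq> 0" "v v* E = 0"
proof -
  let ?E = "transpose (int_mat_to E :: rat^'n^'n)"
  have "det ?E = 0" using assms by (simp add: det_int_mat_to)
  then have "\<not> invertible ?E" by (simp add: invertible_det_nz)
  then obtain x where x: "x \<noteq> 0" "?E *v x = 0"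
    unfolding invertible_left_inverse matrix_left_invertible_ker by blast
  obtain d where d: "d \<noteq> 0" "\<And>i. \<exists>z. of_int d * x $ i = of_int z"
    using common_denominator[of "UNIV :: 'n set" "\<lambda>i. x $ i"] by auto
  then obtain z where z: "\<And>i. of_int d * x $ i = of_int (z i)" by metis
  show thesis
  proof
    show "(\<chi> i. z i) \<noteq> 0"
    proof
      assume "(\<chi> i. z i) = 0"
      then have "z i = 0" for i by (simp add: vec_eq_iff)
      then have "x $ i = 0" for i using z[of i] d(1) by simp
      then show False using x(1) by (simp add: vec_eq_iff)
    qed
    show "(\<chi> i. z i) v* E = 0"
    proof (subst vec_eq_iff, intro allI)
      fix j
      have "of_int (\<Sum>i\<in>UNIV. z i * E $ i $ j) = (\<Sum>i\<in>UNIV. of_int d * x $ i * of_int (E $ i $ j))"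
        by (simp add: z)
      also have "\<dots> = of_int d * (x v* int_mat_to E) $ j"
        by (simp add: vector_matrix_mult_def sum_distrib_left mult_ac)
      also have "\<dots> = 0" using x(2) by simp
      finally have "(\<Sum>i\<in>UNIV. z i * E $ i $ j) = 0" by (simp only: of_int_eq_0_iff)
      then show "((\<chi> i. z i) v* E) $ j = 0 $ j" by (simp add: vector_matrix_mult_def mult.commute)
    qed
  qed
qed

text \<open>An integral null vector is shortened by Euclidean steps on two nonzero coordinates, each a
  unimodular change of basis, until it is supported on one coordinate and kills a row.\<close>
lemma null_vector_reduction:
  fixes X P :: "int^'n^'n" and v :: "int^'n"
  assumes "invertible P" and "v \<noteq> 0" and "v v* (P ** X ** transpose P) = 0"
    and "\<And>i. i \<notin> S \<Longrightarrow> v $ i = 0"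
    and "\<And>i. i \<notin> S \<Longrightarrow> (P ** X ** transpose P) $ i = 0"
  shows "\<exists>P' s. invertible P' \<and> s \<in> S \<and> (\<forall>i. i \<notin> S - {s} \<longrightarrow> (P' ** X ** transpose P') $ i = 0)"
  using assms
proof (induction "nat (\<Sum>i\<in>UNIV. \<bar>v $ i\<bar>)" arbitrary: v P rule: less_induct)
  case less
  let ?Y = "P ** X ** transpose P"
  obtain s0 where s0: "v $ s0 \<noteq> 0" using less.prems(2) by (auto simp: vec_eq_iff)
  show ?case
  proof (cases "\<exists>t. t \<noteq> s0 \<and> v $ t \<noteq> 0")
    case False
    have "v $ s0 * ?Y $ s0 $ j = 0" for j
    proof -
      have "0 = (v v* ?Y) $ j" by (simp add: less.prems(3))
      also have "\<dots> = (\<Sum>i\<in>UNIV. if i = s0 then v $ s0 * ?Y $ s0 $ j else 0)"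
        unfolding vector_matrix_mult_def vec_lambda_beta
        by (intro sum.cong refl) (use False in \<open>auto simp: mult.commute\<close>)
      finally show ?thesis by simp
    qed
    then have "?Y $ s0 = 0" using s0 by (simp add: vec_eq_iff)
    moreover have "s0 \<in> S" using s0 less.prems(4) by blast
    ultimately show ?thesis using less.prems(1,5) by blast
  next
    case True
    then obtain s t where st: "s \<noteq> t" "v $ s \<noteq> 0" "v $ t \<noteq> 0" "\<bar>v $ t\<bar> \<le> \<bar>v $ s\<bar>"
      using s0 by (metis linear)
    \<comment> \<open>The sign \<open>c\<close> is chosen so that adding \<open>c * v $ t\<close> to
      the larger coordinate \<open>v $ s\<close> shortens it, while \<open>v $ t\<close> stays
      nonzero. \<open>E c\<close> is the elementary matrix doing this.\<close>
    define c where "c = - (sgn (v $ s) * sgn (v $ t))"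
    define E where "E c = (mat 1 + (\<chi> i j. if i = t \<and> j = s then c else 0) :: int^'n^'n)" for c
    have E_mult: "E a ** E b = E (a + b)" for a b
    proof -
      have add_rdistrib: "(A + B) ** C = A ** C + B ** C" for A B C :: "int^'n^'n"
        by (simp add: vec_eq_iff matrix_matrix_mult_def distrib_right sum.distrib)
      have "(\<Sum>k\<in>UNIV. (if i = t \<and> k = s then a else 0) * (if k = t \<and> j = s then b else 0)) = 0" for i j
        using st(1) by (intro sum.neutral) auto
      then have "(\<chi> i j. if i = t \<and> j = s then a else 0) ** (\<chi> i j. if i = t \<and> j = s then b else 0) = (0 :: int^'n^'n)"
        by (simp add: vec_eq_iff matrix_matrix_mult_def)
      then have "E a ** E b = mat 1 + ((\<chi> i j. if i = t \<and> j = s then a else 0) + (\<chi> i j. if i = t \<and> j = s then b else 0))"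
        by (simp add: E_def matrix_add_ldistrib add_rdistrib add.assoc)
      also have "\<dots> = E (a + b)" by (auto simp: E_def vec_eq_iff)
      finally show ?thesis .
    qed
    have E_0: "E 0 = mat 1" by (simp add: E_def vec_eq_iff)
    have E_inv: "invertible (E a)" for a
      unfolding invertible_def by (rule exI[of _ "E (- a)"]) (simp add: E_mult E_0)
    have E_vec: "(v v* E a) $ i = v $ i + (if i = s then v $ t * a else 0)" for i a
    proof -
      have "(v v* E a) $ i = (\<Sum>k\<in>UNIV. (if k = i then v $ i else 0) + (if k = t then if i = s then v $ t * a else 0 else 0))"
        unfolding vector_matrix_mult_def vec_lambda_beta
        by (intro sum.cong refl) (use st(1) in \<open>auto simp: E_def mat_def algebra_simps\<close>)
      then show ?thesis by (simp add: sum.distrib)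
    qed
    \<comment> \<open>The basis changes by the inverse \<open>E (- c)\<close>: the factors
      \<open>E c\<close> and \<open>E (- c)\<close> cancel, so the new vector is again a null
      vector.\<close>
    let ?v = "v v* E c" and ?P = "E (- c) ** P"
    have Y': "?P ** X ** transpose ?P = E (- c) ** ?Y ** transpose (E (- c))"
      by (simp add: congruence_trans)
    have small: "\<bar>?v $ s\<bar> < \<bar>v $ s\<bar>"
      using st unfolding E_vec c_def by (auto simp: sgn_if abs_if split: if_splits)
    have "(\<Sum>i\<in>UNIV. \<bar>?v $ i\<bar>) < (\<Sum>i\<in>UNIV. \<bar>v $ i\<bar>)"
      by (rule sum_strict_mono_ex1) (use small in \<open>auto simp: E_vec\<close>)
    then have "nat (\<Sum>i\<in>UNIV. \<bar>?v $ i\<bar>) < nat (\<Sum>i\<in>UNIV. \<bar>v $ i\<bar>)"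
      by (subst nat_less_eq_zless) (simp_all add: sum_nonneg)
    moreover have "invertible ?P" using E_inv less.prems(1) by (rule invertible_mult)
    moreover have "?v \<noteq> 0"
    proof
      assume "?v = 0"
      then have "?v $ t = 0" by simp
      then show False using st by (simp add: E_vec)
    qed
    moreover have "?v v* (?P ** X ** transpose ?P) = 0"
    proof -
      have "?v v* (?P ** X ** transpose ?P) = v v* ((E c ** E (- c)) ** (?Y ** transpose (E (- c))))"
        unfolding Y' by (simp add: vector_matrix_mul_assoc matrix_mul_assoc)
      also have "\<dots> = (v v* ?Y) v* transpose (E (- c))"
        by (simp add: E_mult E_0 vector_matrix_mul_assoc del: vector_transpose_matrix)
      finally show ?thesis using less.prems(3) by simp
    qed
    moreover have "t \<in> S" "s \<in> S" using st less.prems(4) by blast+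
    moreover have "?v $ i = 0" if "i \<notin> S" for i
      using that \<open>s \<in> S\<close> less.prems(4) by (auto simp: E_vec)
    moreover have "(?P ** X ** transpose ?P) $ i = 0" if "i \<notin> S" for i
    proof -
      \<comment> \<open>Left multiplication by \<open>E (- c)\<close> alters only row
        \<open>t\<close>, which belongs to \<open>S\<close>.\<close>
      have "(E (- c) ** ?Y) $ i = ?Y $ i"
      proof -
        have "(\<Sum>k\<in>UNIV. E (- c) $ i $ k * ?Y $ k $ j) = (\<Sum>k\<in>UNIV. if k = i then ?Y $ i $ j else 0)" for j
          by (intro sum.cong refl) (use that \<open>t \<in> S\<close> in \<open>auto simp: E_def mat_def\<close>)
        then show ?thesis by (simp add: vec_eq_iff matrix_matrix_mult_def)
      qed
      then have "(E (- c) ** ?Y) $ i = 0" using less.prems(5) that by simp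
      then show ?thesis unfolding Y' by (simp add: vec_eq_iff matrix_matrix_mult_def)
    qed
    ultimately show ?thesis by (intro less.hyps[of ?v ?P])
  qed
qed

text \<open>A support \<open>S\<close> of least size works: a nonzero null vector on it would allow
  one more row to be cleared.\<close>

lemma unimodular_radical_splitting:
  fixes X :: "int^'n^'n"
  shows "\<exists>(P :: int^'n^'n) S. invertible P \<and> (\<forall>i. i \<notin> S \<longrightarrow> (P ** X ** transpose P) $ i = 0) \<and>
    (\<forall>v. (\<forall>i. i \<notin> S \<longrightarrow> v $ i = 0) \<longrightarrow> v v* (P ** X ** transpose P) = 0 \<longrightarrow> v = 0)"
proof -
  define Q where "Q S \<longleftrightarrow> (\<exists>P. invertible P \<and> (\<forall>i. i \<notin> S \<longrightarrow> (P ** X ** transpose P) $ i = 0))" for S :: "'n set"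
  have "invertible (mat 1 :: int^'n^'n)" by (auto simp: invertible_def)
  then have "Q UNIV" by (auto simp: Q_def)
  define S where "S = (ARG_MIN card S. Q S)"
  have S: "Q S" "\<And>T. Q T \<Longrightarrow> card S \<le> card T"
    using arg_min_nat_lemma[of Q, OF \<open>Q UNIV\<close>, of card] by (auto simp: S_def)
  then obtain P where P: "invertible P" "\<And>i. i \<notin> S \<Longrightarrow> (P ** X ** transpose P) $ i = 0"
    by (auto simp: Q_def)
  have "v = 0" if "\<And>i. i \<notin> S \<Longrightarrow> v $ i = 0" "v v* (P ** X ** transpose P) = 0" for v
  proof (rule ccontr)
    assume "v \<noteq> 0"
    from null_vector_reduction[OF P(1) this that(2,1) P(2)]
    obtain P' s where "invertible P'" "s \<in> S" "\<forall>i. i \<notin> S - {s} \<longrightarrow> (P' ** X ** transpose P') $ i = 0"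
      by blast
    then have "Q (S - {s})" by (auto simp: Q_def)
    from S(2)[OF this] \<open>s \<in> S\<close> show False
      by (metis card_Diff1_less finite not_less)
  qed
  with P show ?thesis by blast
qed

section \<open>Antisymmetric integer matrices that are congruent in both directions\<close>

lemma antisymmetric_mat_nth: "antisymmetric_mat X \<longleftrightarrow> (\<forall>i j. X $ j $ i = - X $ i $ j)"
  by (auto simp: antisymmetric_mat_def transpose_def vec_eq_iff)

lemma antisymmetric_mat_congruence:
  fixes X P :: "'k::comm_ring_1^'n^'n"
  assumes "antisymmetric_mat X"
  shows "antisymmetric_mat (P ** X ** transpose P)"
proof -
  have X: "X $ j $ i = - X $ i $ j" for i j using assms unfolding antisymmetric_mat_nth by blast
  have "(\<Sum>i\<in>UNIV. \<Sum>j\<in>UNIV. P $ b $ i * X $ i $ j * P $ a $ j) =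
      - (\<Sum>i\<in>UNIV. \<Sum>j\<in>UNIV. P $ a $ i * X $ i $ j * P $ b $ j)" for a b
    unfolding sum_negf[symmetric] by (subst sum.swap, intro sum.cong refl, subst X) (simp add: mult_ac)
  then show ?thesis unfolding antisymmetric_mat_nth congruence_nth by blast
qed

lemma row_zero_vec_mult:
  fixes Y :: "'k::comm_ring_1^'n^'m"
  assumes "\<And>i. i \<notin> T \<Longrightarrow> Y $ i = 0" and "\<And>i. i \<in> T \<Longrightarrow> w $ i = 0"
  shows "w v* Y = 0"
proof -
  have "w $ i * Y $ i $ j = 0" for i j using assms[of i] by (cases "i \<in> T") auto
  then show ?thesis by (simp add: vec_eq_iff vector_matrix_mult_def mult.commute)
qed

text \<open>The dimension count for the injection \<open>v \<mapsto> (v B)|_T\<close> is done by a square matrix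
  with a vanishing column.\<close>
lemma nondegenerate_support_card_le:
  fixes X Y B :: "int^'n^'n"
  assumes X: "X = B ** Y ** transpose B"
    and Y0: "\<And>i. i \<notin> T \<Longrightarrow> Y $ i = 0"
    and nondeg: "\<And>v. (\<And>i. i \<notin> S \<Longrightarrow> v $ i = 0) \<Longrightarrow> v v* X = 0 \<Longrightarrow> v = 0"
  shows "card S \<le> card T"
proof (rule ccontr)
  assume "\<not> card S \<le> card T"
  then have less: "card T < card S" by simp
  then obtain f where f: "inj_on f T" "f ` T \<subseteq> S"
    using card_le_inj[of T S] by auto
  have "f ` T \<noteq> S" using less card_image[OF f(1)] by auto
  then obtain s0 where s0: "s0 \<in> S" "s0 \<notin> f ` T" using f(2) by blast
  \<comment> \<open>The rows in \<open>S\<close> carry the columns of \<open>B\<close> indexed by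
    \<open>T\<close>, moved by \<open>f\<close> to columns in \<open>S\<close>; the other rows are
    those of the identity. Column \<open>s0\<close> is empty, and a null vector is forced to be
    supported on \<open>S\<close> with \<open>v v* B\<close> vanishing on \<open>T\<close>.\<close>
  define E :: "int^'n^'n" where "E = (\<chi> i c. if i \<in> S
     then if c \<in> f ` T then B $ i $ inv_into T f c else 0 else if i = c then 1 else 0)"
  have "column s0 E = 0" using s0 by (auto simp: column_def E_def vec_eq_iff)
  then have "det E = 0" by (rule det_zero_column(1))
  then obtain v where v: "v \<noteq> 0" "v v* E = 0" by (rule int_det_0_kernel)
  have vE: "(\<Sum>k\<in>UNIV. v $ k * E $ k $ c) = 0" for c
    using v(2) by (simp add: vec_eq_iff vector_matrix_mult_def mult.commute)
  have v0: "v $ i = 0" if "i \<notin> S" for i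
  proof -
    have "(\<Sum>k\<in>UNIV. v $ k * E $ k $ i) = (\<Sum>k\<in>UNIV. if k = i then v $ i else 0)"
      by (intro sum.cong refl) (use that f(2) in \<open>auto simp: E_def\<close>)
    then show ?thesis using vE[of i] by simp
  qed
  have "(v v* B) $ t = 0" if t: "t \<in> T" for t
  proof -
    have "(\<Sum>k\<in>UNIV. v $ k * B $ k $ t) = (\<Sum>k\<in>UNIV. v $ k * E $ k $ f t)"
      by (intro sum.cong refl) (use t v0 f(1) in \<open>auto simp: E_def inv_into_f_f\<close>)
    then show ?thesis using vE[of "f t"] by (simp add: vector_matrix_mult_def mult.commute)
  qed
  then have "(v v* B) v* Y = 0" using Y0 by (intro row_zero_vec_mult[of T]) auto
  then have "v v* X = 0" unfolding X by (simp add: vector_matrix_mul_assoc[symmetric])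
  then show False using nondeg v0 v(1) by blast
qed

lemma exists_bij_image:
  fixes S T :: "'n::finite set"
  assumes "card S = card T"
  obtains \<pi> where "bij \<pi>" "\<pi> ` S = T"
proof -
  obtain f where f: "bij_betw f S T" using assms finite_same_card_bij[of S T] by auto
  have "card (- S) = card (- T)" using assms by (simp add: Compl_eq_Diff_UNIV card_Diff_subset)
  then obtain g where g: "bij_betw g (- S) (- T)" using finite_same_card_bij[of "- S" "- T"] by auto
  let ?h = "\<lambda>x. if x \<in> S then f x else g x"
  have h1: "bij_betw ?h S T" using f by (rule bij_betw_cong[THEN iffD1, rotated]) simp
  have "bij_betw ?h (- S) (- T)" using g by (rule bij_betw_cong[THEN iffD1, rotated]) simp
  from bij_betw_combine[OF h1 this] have "bij ?h" by simp
  then show thesis by (rule that) (use h1 in \<open>simp add: bij_betw_def\<close>)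
qed

text \<open>On the complements of the supports \<open>B\<close> and \<open>A\<close> are replaced by a permutation and its inverse;
  the product of the new matrices then fixes the nondegenerate matrix \<open>X + D\<close>.\<close>
lemma mutually_congruent_nondegenerate:
  fixes X Y A B :: "int^'n^'n"
  assumes anti: "antisymmetric_mat X" "antisymmetric_mat Y"
    and X: "X = B ** Y ** transpose B" and Y: "Y = A ** X ** transpose A"
    and X0: "\<And>i. i \<notin> S \<Longrightarrow> X $ i = 0" and Y0: "\<And>i. i \<notin> T \<Longrightarrow> Y $ i = 0"
    and nondeg: "\<And>v. (\<And>i. i \<notin> S \<Longrightarrow> v $ i = 0) \<Longrightarrow> v v* X = 0 \<Longrightarrow> v = 0"
    and ST: "card S = card T"
  shows "\<exists>W. invertible W \<and> Y = W ** X ** transpose W"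
proof -
  obtain \<pi> where \<pi>: "bij \<pi>" "\<pi> ` S = T" using exists_bij_image[OF ST] .
  have \<pi>_iff: "\<pi> i \<in> T \<longleftrightarrow> i \<in> S" for i
    using \<pi> by (metis bij_is_inj inj_image_mem_iff)
  define cut where "cut S T C \<sigma> = (\<chi> i j. if i \<in> S then if j \<in> T then C $ i $ j else 0
      else if \<sigma> i = j then 1 else 0)" for S T and C :: "int^'n^'n" and \<sigma> :: "'n \<Rightarrow> 'n"
  \<comment> \<open>By antisymmetry \<open>X'\<close> and \<open>Y'\<close> vanish outside the
    blocks on \<open>S'\<close> and \<open>T'\<close>, so only the block of \<open>C\<close> between
    \<open>S'\<close> and \<open>T'\<close> matters for the congruence.\<close>
  have cut: "X' = cut S' T' C \<sigma> ** Y' ** transpose (cut S' T' C \<sigma>)"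
    if X': "X' = C ** Y' ** transpose C" and anti': "antisymmetric_mat X'" "antisymmetric_mat Y'"
      and 0: "\<And>i. i \<notin> S' \<Longrightarrow> X' $ i = 0" "\<And>i. i \<notin> T' \<Longrightarrow> Y' $ i = 0"
      and \<sigma>: "\<And>i. i \<notin> S' \<Longrightarrow> \<sigma> i \<notin> T'"
    for S' T' and C X' Y' :: "int^'n^'n" and \<sigma>
  proof -
    have Y'0: "Y' $ i $ j = 0" if "i \<notin> T' \<or> j \<notin> T'" for i j
      using that 0(2)[of i] 0(2)[of j] anti'(2) unfolding antisymmetric_mat_nth
      by (metis neg_0_equal_iff_equal zero_index)
    have X'0: "X' $ i $ j = 0" if "i \<notin> S' \<or> j \<notin> S'" for i j
      using that 0(1)[of i] 0(1)[of j] anti'(1) unfolding antisymmetric_mat_nth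
      by (metis neg_0_equal_iff_equal zero_index)
    have "X' $ a $ b = (\<Sum>i\<in>UNIV. \<Sum>j\<in>UNIV. cut S' T' C \<sigma> $ a $ i * Y' $ i $ j * cut S' T' C \<sigma> $ b $ j)" for a b
    proof (cases "a \<in> S' \<and> b \<in> S'")
      case True
      then have eq: "cut S' T' C \<sigma> $ a $ i * Y' $ i $ j * cut S' T' C \<sigma> $ b $ j = C $ a $ i * Y' $ i $ j * C $ b $ j" for i j
        using Y'0[of i j] by (auto simp: cut_def)
      show ?thesis by (simp only: X' congruence_nth eq)
    next
      case False
      then have eq: "cut S' T' C \<sigma> $ a $ i * Y' $ i $ j * cut S' T' C \<sigma> $ b $ j = 0" for i j
        using \<sigma> Y'0[of i j] by (auto simp: cut_def)
      show ?thesis unfolding eq using X'0 False by simp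
    qed
    then show ?thesis by (simp add: vec_eq_iff congruence_nth)
  qed
  define U where "U = cut S T B \<pi>"
  define W where "W = cut T S A (inv \<pi>)"
  have XU: "X = U ** Y ** transpose U"
    unfolding U_def by (rule cut[OF X anti X0 Y0]) (simp_all add: \<pi>_iff)
  have inv_iff: "inv \<pi> i \<in> S \<longleftrightarrow> i \<in> T" for i
    using \<pi>_iff[of "inv \<pi> i"] \<pi>(1) by (simp add: bij_is_surj surj_f_inv_f)
  have YW: "Y = W ** X ** transpose W"
    unfolding W_def by (rule cut[OF Y anti(2,1) Y0 X0]) (simp_all add: inv_iff)
  define C where "C = U ** W"
  define D :: "int^'n^'n" where "D = (\<chi> i j. if i = j \<and> i \<notin> S then 1 else 0)"
  \<comment> \<open>\<open>C\<close> is block diagonal with the identity as its block off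
    \<open>S\<close>, since \<open>inv \<pi>\<close> undoes \<open>\<pi>\<close> there.\<close>
  have C: "C $ i $ j = (if i \<in> S then C $ i $ j else if i = j then 1 else 0)"
    and C0: "i \<in> S \<Longrightarrow> j \<notin> S \<Longrightarrow> C $ i $ j = 0" for i j
  proof -
    show "C $ i $ j = 0" if "i \<in> S" "j \<notin> S"
    proof -
      have "U $ i $ k * W $ k $ j = 0" for k
        using that by (cases "k \<in> T") (auto simp: U_def W_def cut_def)
      then show ?thesis by (simp add: C_def matrix_matrix_mult_def del: mult_eq_0_iff)
    qed
    show "C $ i $ j = (if i \<in> S then C $ i $ j else if i = j then 1 else 0)"
    proof (cases "i \<in> S")
      case False
      have "(\<Sum>k\<in>UNIV. U $ i $ k * W $ k $ j) = (\<Sum>k\<in>UNIV. if k = \<pi> i then W $ \<pi> i $ j else 0)"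
        by (intro sum.cong refl) (use False in \<open>auto simp: U_def cut_def\<close>)
      also have "\<dots> = (if i = j then 1 else 0)"
        using False \<pi>_iff[of i] \<pi>(1) by (simp add: W_def cut_def bij_is_inj inv_f_f)
      finally show ?thesis using False by (simp add: C_def matrix_matrix_mult_def)
    qed simp
  qed
  have XC: "C ** X ** transpose C = X"
    unfolding C_def congruence_trans[symmetric] YW[symmetric] XU[symmetric] ..
  have DC: "C ** D ** transpose C = D"
  proof -
    have "(\<Sum>i\<in>UNIV. \<Sum>j\<in>UNIV. C $ a $ i * D $ i $ j * C $ b $ j) = D $ a $ b" for a b
    proof -
      have "(\<Sum>j\<in>UNIV. C $ a $ i * D $ i $ j * C $ b $ j) = (if i = a then D $ a $ b else 0)" for i
      proof -
        have "(\<Sum>j\<in>UNIV. C $ a $ i * D $ i $ j * C $ b $ j)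
          = (\<Sum>j\<in>UNIV. if j = i then if i \<in> S then 0 else C $ a $ i * C $ b $ i else 0)"
          by (intro sum.cong refl) (auto simp: D_def)
        also have "\<dots> = (if i \<in> S then 0 else C $ a $ i * C $ b $ i)" by simp
        also have "\<dots> = (if i = a then D $ a $ b else 0)"
          using C[of a i] C[of b i] C0[of a i] C0[of b i] by (auto simp: D_def split: if_splits)
        finally show ?thesis .
      qed
      then show ?thesis by simp
    qed
    then show ?thesis by (simp add: vec_eq_iff congruence_nth)
  qed
  have XD: "X + D = C ** (X + D) ** transpose C"
  proof -
    have "(C ** (X + D) ** transpose C) $ a $ b = (C ** X ** transpose C) $ a $ b + (C ** D ** transpose C) $ a $ b" for a b
      unfolding congruence_nth by (simp add: distrib_left distrib_right sum.distrib)
    then show ?thesis by (simp add: XC DC vec_eq_iff)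
  qed
  \<comment> \<open>\<open>X\<close> and \<open>D\<close> live on complementary coordinates: a null
    vector of the sum vanishes off \<open>S\<close> because of \<open>D\<close>, and then on
    \<open>S\<close> by nondegeneracy of \<open>X\<close>.\<close>
  have "det (X + D) \<noteq> 0"
  proof
    assume "det (X + D) = 0"
    then obtain v where v: "v \<noteq> 0" "v v* (X + D) = 0" by (rule int_det_0_kernel)
    have vX: "(v v* X) $ i + (if i \<in> S then 0 else v $ i) = 0" for i
    proof -
      have "(\<Sum>k\<in>UNIV. v $ k * D $ k $ i) = (\<Sum>k\<in>UNIV. if k = i then if i \<in> S then 0 else v $ i else 0)"
        by (intro sum.cong refl) (auto simp: D_def)
      then have "(v v* D) $ i = (if i \<in> S then 0 else v $ i)"
        by (simp add: vector_matrix_mult_def mult.commute)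
      moreover have "(v v* X) $ i + (v v* D) $ i = 0"
        using v(2) by (simp add: vec_eq_iff vector_matrix_mult_def distrib_right distrib_left sum.distrib)
      ultimately show ?thesis by simp
    qed
    have X_col: "X $ k $ i = 0" if "i \<notin> S" for i k
      using X0[OF that] anti(1) unfolding antisymmetric_mat_nth by (metis neg_0_equal_iff_equal zero_index)
    have v0: "v $ i = 0" if "i \<notin> S" for i
      using vX[of i] X_col[OF that] that by (simp add: vector_matrix_mult_def)
    have "(v v* X) $ i = 0" for i using vX[of i] v0[of i] by (simp split: if_splits)
    then have "v v* X = 0" by (simp add: vec_eq_iff)
    then show False using nondeg v0 v(1) by blast
  qed
  then have "det (int_mat_to (X + D) :: rat^'n^'n) \<noteq> 0" by (simp add: det_int_mat_to)
  moreover have "int_mat_to (X + D) = int_mat_to C ** int_mat_to (X + D) ** transpose (int_mat_to C :: rat^'n^'n)"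
    by (subst XD) (simp add: int_mat_to_mult int_mat_to_transpose)
  ultimately have "\<bar>det C\<bar> = 1" by (rule abs_det_eq_1_if_congruence_fixes)
  then have "invertible W" unfolding C_def by (rule int_invertible_factors(1))
  with YW show ?thesis by blast
qed

text \<open>Unimodular changes of basis split off both radicals and keep the two congruences, the
  supports have equal size by two inequalities, and the nondegenerate case is transported
  back.\<close>

lemma mutually_congruent_imp_unimodular_congruent:
  fixes X Y A B :: "int^'n^'n"
  assumes anti: "antisymmetric_mat X"
    and X: "X = B ** Y ** transpose B" and Y: "Y = A ** X ** transpose A"
  shows "\<exists>W. invertible W \<and> Y = W ** X ** transpose W"
proof -
  have anti': "antisymmetric_mat Y" unfolding Y using anti by (rule antisymmetric_mat_congruence)
  obtain P :: "int^'n^'n" and S where P: "invertible P" "\<forall>i. i \<notin> S \<longrightarrow> (P ** X ** transpose P) $ i = 0"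
    "\<forall>v. (\<forall>i. i \<notin> S \<longrightarrow> v $ i = 0) \<longrightarrow> v v* (P ** X ** transpose P) = 0 \<longrightarrow> v = 0"
    using unimodular_radical_splitting[of X] by blast
  obtain Q :: "int^'n^'n" and T where Q: "invertible Q" "\<forall>i. i \<notin> T \<longrightarrow> (Q ** Y ** transpose Q) $ i = 0"
    "\<forall>v. (\<forall>i. i \<notin> T \<longrightarrow> v $ i = 0) \<longrightarrow> v v* (Q ** Y ** transpose Q) = 0 \<longrightarrow> v = 0"
    using unimodular_radical_splitting[of Y] by blast
  obtain P' where P': "P' ** P = mat 1" "P ** P' = mat 1" using P(1) by (auto simp: invertible_def)
  obtain Q' where Q': "Q' ** Q = mat 1" "Q ** Q' = mat 1" using Q(1) by (auto simp: invertible_def)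
  define X1 where "X1 = P ** X ** transpose P"
  define Y1 where "Y1 = Q ** Y ** transpose Q"
  have X_eq: "X = P' ** X1 ** transpose P'"
    unfolding X1_def congruence_trans P' by simp
  have Y_eq: "Y = Q' ** Y1 ** transpose Q'"
    unfolding Y1_def congruence_trans Q' by simp
  have X1: "X1 = (P ** B ** Q') ** Y1 ** transpose (P ** B ** Q')"
    unfolding congruence_trans[symmetric] Y_eq[symmetric] X[symmetric] X1_def ..
  have Y1: "Y1 = (Q ** A ** P') ** X1 ** transpose (Q ** A ** P')"
    unfolding congruence_trans[symmetric] X_eq[symmetric] Y[symmetric] Y1_def ..
  note P = P(2,3)[folded X1_def, rule_format] and Q = Q(2,3)[folded Y1_def, rule_format]
  have "card S \<le> card T" by (rule nondegenerate_support_card_le[OF X1 Q(1) P(2)])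
  moreover have "card T \<le> card S" by (rule nondegenerate_support_card_le[OF Y1 P(1) Q(2)])
  ultimately have card: "card S = card T" by simp
  have "antisymmetric_mat X1" "antisymmetric_mat Y1"
    unfolding X1_def Y1_def using anti anti' by (simp_all add: antisymmetric_mat_congruence)
  from mutually_congruent_nondegenerate[OF this X1 Y1 P(1) Q(1) P(2) card]
  obtain W where W: "invertible W" "Y1 = W ** X1 ** transpose W" by blast
  have "Y = (Q' ** W ** P) ** X ** transpose (Q' ** W ** P)"
    unfolding congruence_trans[symmetric] X1_def[symmetric] W(2)[symmetric] by (rule Y_eq)
  moreover have "invertible (Q' ** W ** P)"
    using W(1) \<open>invertible P\<close> Q' by (intro invertible_mult) (auto simp: invertible_def)
  ultimately show ?thesis by blast
qed

section \<open>The entry subgroup and the theorem\<close>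

lemma vector_space_of_rat: "vector_space (\<lambda>(q::rat) (x::'k::field_char_0). of_rat q * x)"
  by unfold_locales (simp_all add: algebra_simps of_rat_add of_rat_mult)

text \<open>A relation with \<open>d i0\<close> nonzero would put \<open>G\<close> into the rational
  span of fewer than \<open>card I\<close> elements, while a basis of \<open>G\<close> consists of
  \<open>card I\<close> rationally independent ones.\<close>

lemma free_abelian_rank_generators_independent:
  fixes x :: "'a \<Rightarrow> 'k::field_char_0"
  assumes I: "finite I"
    and free: "free_abelian_rank G (card I)"
    and gen: "\<And>g. g \<in> G \<Longrightarrow> \<exists>c::'a \<Rightarrow> int. g = (\<Sum>i\<in>I. of_int (c i) * x i)"
    and rel: "(\<Sum>i\<in>I. of_int (d i) * x i) = 0"
    and "i0 \<in> I"
  shows "d i0 = 0"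
proof (rule ccontr)
  assume d: "d i0 \<noteq> 0"
  interpret Q: vector_space "\<lambda>(q::rat) (x::'k). of_rat q * x" by (rule vector_space_of_rat)
  obtain b where G: "G = {(\<Sum>l<card I. of_int (c l) * b l) | c :: nat \<Rightarrow> int. True}"
    and ind: "\<And>c :: nat \<Rightarrow> int. (\<Sum>l<card I. of_int (c l) * b l) = 0 \<Longrightarrow> \<forall>l<card I. c l = 0"
    using free unfolding free_abelian_rank_def by blast
  \<comment> \<open>Independence over the rationals is a property of sets, so repeated basis
    elements must be excluded first; they would give an integer relation.\<close>
  have inj: "inj_on b {..<card I}"
  proof (rule inj_onI, rule ccontr)
    fix k l assume *: "k \<in> {..<card I}" "l \<in> {..<card I}" "b k = b l" "k \<noteq> l"
    let ?c = "\<lambda>m. (if m = k then 1 else 0) - (if m = l then 1 else 0) :: int"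
    have "(\<Sum>m<card I. of_int (?c m) * b m) =
       (\<Sum>m<card I. (if m = k then b k else 0) - (if m = l then b l else 0))"
      by (intro sum.cong refl) auto
    also have "\<dots> = 0" using * by (simp add: sum_subtractf)
    finally show False using ind[of ?c] * by auto
  qed
  have b_ind: "Q.independent (b ` {..<card I})"
  proof (rule Q.independent_if_scalars_zero)
    fix f :: "'k \<Rightarrow> rat" and y
    assume s: "(\<Sum>y\<in>b ` {..<card I}. of_rat (f y) * y) = 0" and y: "y \<in> b ` {..<card I}"
    \<comment> \<open>Clearing denominators reduces rational independence to the integral
      independence of the basis.\<close>
    obtain e where e: "e \<noteq> 0" "\<And>l. l \<in> {..<card I} \<Longrightarrow> \<exists>z. of_int e * f (b l) = of_int z"
      using common_denominator[of "{..<card I}" "\<lambda>l. f (b l)"] by auto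
    then obtain z where z: "\<And>l. l \<in> {..<card I} \<Longrightarrow> of_int e * f (b l) = of_int (z l)" by metis
    have "of_int (z l) = of_int e * (of_rat (f (b l)) :: 'k)" if "l \<in> {..<card I}" for l
      using arg_cong[OF z[OF that], of "of_rat :: rat \<Rightarrow> 'k"] by (simp add: of_rat_mult)
    then have "(\<Sum>l<card I. of_int (z l) * b l) = of_int e * (\<Sum>l<card I. of_rat (f (b l)) * b l)"
      by (simp add: sum_distrib_left mult.assoc)
    also have "(\<Sum>l<card I. of_rat (f (b l)) * b l) = 0"
      using s by (simp add: sum.reindex[OF inj])
    finally have zz: "\<forall>l<card I. z l = 0" using ind by simp
    obtain l where "l < card I" "y = b l" using y by auto
    then show "f y = 0" using z[of l] zz e(1) by simp
  qed simp
  have b_span: "b ` {..<card I} \<subseteq> Q.span (x ` (I - {i0}))"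
  proof -
    have base: "x i \<in> Q.span (x ` (I - {i0}))" if "i \<in> I - {i0}" for i
      using that by (intro Q.span_base) blast
    have int: "of_int m * y \<in> Q.span A" if "y \<in> Q.span A" for m y A
      using Q.span_scale[OF that, of "of_int m"] by simp
    have sum_rest: "(\<Sum>i\<in>I - {i0}. of_int (c i) * x i) \<in> Q.span (x ` (I - {i0}))" for c :: "'a \<Rightarrow> int"
      by (intro Q.span_sum int base)
    have "x i0 \<in> Q.span (x ` (I - {i0}))"
    proof -
      have "of_int (d i0) * x i0 + (\<Sum>i\<in>I - {i0}. of_int (d i) * x i) = 0"
        using rel sum.remove[OF I \<open>i0 \<in> I\<close>, of "\<lambda>i. of_int (d i) * x i"] by simp
      then have "of_int (d i0) * x i0 = - (\<Sum>i\<in>I - {i0}. of_int (d i) * x i)"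
        by (simp add: eq_neg_iff_add_eq_0)
      then have "of_int (d i0) * x i0 \<in> Q.span (x ` (I - {i0}))"
        using Q.span_neg[OF sum_rest] by simp
      from Q.span_scale[OF this, of "inverse (of_int (d i0))"] show ?thesis
        using d by (simp add: of_rat_inverse mult.assoc[symmetric])
    qed
    then have all: "x i \<in> Q.span (x ` (I - {i0}))" if "i \<in> I" for i
      using base that by (cases "i = i0") auto
    have "b l \<in> Q.span (x ` (I - {i0}))" if "l < card I" for l
    proof -
      have "b l = (\<Sum>m<card I. if m = l then b l else 0)" using that by simp
      also have "\<dots> = (\<Sum>m<card I. of_int (if m = l then 1 else 0) * b m)" by (intro sum.cong refl) auto
      finally have e: "b l = (\<Sum>m<card I. of_int (if m = l then 1 else 0) * b m)" .
      have "\<exists>c :: nat \<Rightarrow> int. b l = (\<Sum>m<card I. of_int (c m) * b m)"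
        by (intro exI[of _ "\<lambda>m. if m = l then 1 else 0"]) (rule e)
      then have "b l \<in> G" unfolding G by simp
      then obtain c :: "'a \<Rightarrow> int" where "b l = (\<Sum>i\<in>I. of_int (c i) * x i)" using gen by blast
      then show ?thesis using all by (simp add: Q.span_sum int)
    qed
    then show ?thesis by blast
  qed
  have "card (b ` {..<card I}) \<le> card (x ` (I - {i0}))"
    using Q.independent_span_bound[OF _ b_ind b_span] I by simp
  also have "\<dots> \<le> card (I - {i0})" using I by (intro card_image_le) simp
  also have "\<dots> < card I" using I \<open>i0 \<in> I\<close> by (rule card_Diff1_less)
  finally show False using card_image[OF inj] by simp
qed

section \<open>Entries above the diagonal, and the free and cyclic cases\<close>

lemma card_less_pairs: "card {(i, j). i < (j :: 'n::{finite,linorder})} = CARD('n) * (CARD('n) - 1) div 2"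
proof -
  let ?U = "{(i, j). i < (j :: 'n)}" and ?D = "{(i, j). j < (i :: 'n)}" and ?E = "range (\<lambda>i::'n. (i, i))"
  have "card ?D = card ?U"
    by (rule bij_betw_same_card[of prod.swap]) (auto simp: bij_betw_def inj_on_def image_iff)
  moreover have "card ?E = CARD('n)" by (rule card_image) (auto simp: inj_on_def)
  moreover have "card (UNIV :: ('n \<times> 'n) set) = card ?U + card ?D + card ?E"
  proof -
    have "(UNIV :: ('n \<times> 'n) set) = (?U \<union> ?D) \<union> ?E" by (auto simp: image_iff)
    moreover have "card ((?U \<union> ?D) \<union> ?E) = card (?U \<union> ?D) + card ?E"
      by (rule card_Un_disjoint) auto
    moreover have "card (?U \<union> ?D) = card ?U + card ?D"
      by (rule card_Un_disjoint) auto
    ultimately show ?thesis by simp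
  qed
  moreover have "card (UNIV :: ('n \<times> 'n) set) = CARD('n) * CARD('n)"
    by (simp add: card_cartesian_product UNIV_Times_UNIV[symmetric] del: UNIV_Times_UNIV)
  ultimately have "2 * card ?U = CARD('n) * CARD('n) - CARD('n)" by simp
  then show ?thesis by (simp add: right_diff_distrib')
qed

text \<open>The lower triangle is folded onto the upper one. The zero diagonal is a separate
  hypothesis because 2 need not be cancellable in the ring.\<close>

lemma antisymmetric_sum_pairs:
  fixes X :: "'k::comm_ring_1^'n::{finite,linorder}^'n::{finite,linorder}"
  assumes anti: "\<And>i j. X $ j $ i = - X $ i $ j" and diag: "\<And>i. X $ i $ i = 0"
  shows "(\<Sum>i\<in>UNIV. \<Sum>j\<in>UNIV. c i j * X $ i $ j) = (\<Sum>(i, j)\<in>{(i, j). i < j}. (c i j - c j i) * X $ i $ j)"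
proof -
  have swap: "(\<Sum>(i, j)\<in>{(i, j). j < i}. c i j * X $ i $ j) = (\<Sum>(i, j)\<in>{(i, j). i < j}. - c j i * X $ i $ j)"
  proof -
    have "(\<Sum>(i, j)\<in>{(i, j). j < i}. c i j * X $ i $ j) = (\<Sum>(i, j)\<in>{(i, j). i < j}. c j i * X $ j $ i)"
      by (rule sum.reindex_bij_witness[of _ prod.swap prod.swap]) auto
    also have "\<dots> = (\<Sum>(i, j)\<in>{(i, j). i < j}. - c j i * X $ i $ j)"
      by (intro sum.cong refl, clarify, subst anti) simp
    finally show ?thesis .
  qed
  have diag_sum: "(\<Sum>(i, j)\<in>range (\<lambda>i. (i, i)). c i j * X $ i $ j) = 0"
    by (rule sum.neutral) (use diag in auto)
  have "(\<Sum>i\<in>UNIV. \<Sum>j\<in>UNIV. c i j * X $ i $ j) = (\<Sum>(i, j)\<in>UNIV. c i j * X $ i $ j)"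
    by (simp add: sum.cartesian_product)
  also have "(UNIV :: ('n \<times> 'n) set) = ({(i, j). i < j} \<union> {(i, j). j < i}) \<union> range (\<lambda>i. (i, i))"
    by (auto simp: image_iff)
  also have "(\<Sum>(i, j)\<in>({(i, j). i < j} \<union> {(i, j). j < i}) \<union> range (\<lambda>i. (i, i)). c i j * X $ i $ j) =
      (\<Sum>(i, j)\<in>{(i, j). i < j} \<union> {(i, j). j < i}. c i j * X $ i $ j)
      + (\<Sum>(i, j)\<in>range (\<lambda>i. (i, i)). c i j * X $ i $ j)"
    by (rule sum.union_disjoint) auto
  also have "(\<Sum>(i, j)\<in>{(i, j). i < j} \<union> {(i, j). j < i}. c i j * X $ i $ j) =
      (\<Sum>(i, j)\<in>{(i, j). i < j}. c i j * X $ i $ j) + (\<Sum>(i, j)\<in>{(i, j). j < i}. c i j * X $ i $ j)"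
    by (rule sum.union_disjoint) auto
  finally have "(\<Sum>i\<in>UNIV. \<Sum>j\<in>UNIV. c i j * X $ i $ j) =
      (\<Sum>(i, j)\<in>{(i, j). i < j}. c i j * X $ i $ j) + (\<Sum>(i, j)\<in>{(i, j). i < j}. - c j i * X $ i $ j)"
    by (simp only: swap diag_sum add_0_right)
  then show ?thesis
    by (simp only: sum.distrib[symmetric] case_prod_unfold left_diff_distrib mult_minus_left add_uminus_conv_diff)
qed

text \<open>Independence of the entries turns \<open>L = C L C\<^sup>T\<close> into the statement that all 2x2 minors of \<open>C\<close> are
  those of the identity, and a right inverse of \<open>C\<close> is then read off these minors.\<close>
lemma free_entries_fixed_imp_invertible:
  fixes L :: "'k::field_char_0^'n::{finite,linorder}^'n::{finite,linorder}"
    and C :: "int^'n::{finite,linorder}^'n::{finite,linorder}"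
  assumes anti: "antisymmetric_mat L"
    and free: "free_abelian_rank (entry_subgroup L) (CARD('n) * (CARD('n) - 1) div 2)"
    and fixed: "L = int_mat_to C ** L ** transpose (int_mat_to C)"
    and two: "\<And>j::'n. \<exists>i. i \<noteq> j"
  shows "\<bar>det C\<bar> = 1"
proof -
  have a: "L $ j $ i = - L $ i $ j" for i j using anti unfolding antisymmetric_mat_nth by blast
  have diag: "L $ i $ i = 0" for i using a[of i i] by (simp add: eq_neg_iff_add_eq_0)
  define I where "I = {(i, j). i < (j :: 'n)}"
  have pairs: "(\<Sum>i\<in>UNIV. \<Sum>j\<in>UNIV. of_int (c i j) * L $ i $ j)
      = (\<Sum>x\<in>I. of_int (c (fst x) (snd x) - c (snd x) (fst x)) * L $ fst x $ snd x)" for c :: "'n \<Rightarrow> 'n \<Rightarrow> int"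
    unfolding antisymmetric_sum_pairs[OF a diag] I_def by (simp add: case_prod_unfold)
  \<comment> \<open>Folded onto the entries above the diagonal, the relation has coefficients
    \<open>c i j - c j i\<close>; there are as many such entries as the rank, so all of these
    vanish.\<close>
  have indep: "c k l = c l k" if rel: "(\<Sum>i\<in>UNIV. \<Sum>j\<in>UNIV. of_int (c i j) * L $ i $ j) = 0" for c :: "'n \<Rightarrow> 'n \<Rightarrow> int" and k l
  proof -
    have "c (fst x) (snd x) - c (snd x) (fst x) = 0" if "x \<in> I" for x
    proof (rule free_abelian_rank_generators_independent[where I = I and G = "entry_subgroup L"
          and x = "\<lambda>x. L $ fst x $ snd x" and d = "\<lambda>x. c (fst x) (snd x) - c (snd x) (fst x)"])
      show "finite I" by simp
      show "free_abelian_rank (entry_subgroup L) (card I)"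
        unfolding I_def card_less_pairs by (rule free)
      show "\<exists>c::'n \<times> 'n \<Rightarrow> int. g = (\<Sum>i\<in>I. of_int (c i) * L $ fst i $ snd i)" if g: "g \<in> entry_subgroup L" for g
      proof -
        obtain c :: "'n \<Rightarrow> 'n \<Rightarrow> int" where "g = (\<Sum>x\<in>I. of_int (c (fst x) (snd x) - c (snd x) (fst x)) * L $ fst x $ snd x)"
          using g unfolding entry_subgroup_def pairs by blast
        then show ?thesis by (intro exI[of _ "\<lambda>x. c (fst x) (snd x) - c (snd x) (fst x)"])
      qed
      show "(\<Sum>i\<in>I. of_int (c (fst i) (snd i) - c (snd i) (fst i)) * L $ fst i $ snd i) = 0"
        using rel unfolding pairs .
    qed fact
    from this[of "(k, l)"] this[of "(l, k)"] show ?thesis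
      by (cases k l rule: linorder_cases) (auto simp: I_def)
  qed
  have minor: "C $ p $ k * C $ q $ l - C $ p $ l * C $ q $ k
     = (if p = k \<and> q = l then 1 else 0) - (if p = l \<and> q = k then 1 else 0)" for p q k l
  proof -
    \<comment> \<open>The coefficients of the relation obtained from the entry at \<open>p\<close>,
      \<open>q\<close> of \<open>L = C L C^T\<close> by moving everything to one side.\<close>
    let ?c = "\<lambda>i j. C $ p $ i * C $ q $ j - (if p = i \<and> q = j then 1 else 0)"
    have "(\<Sum>i\<in>UNIV. \<Sum>j\<in>UNIV. of_int (?c i j) * L $ i $ j)
      = (\<Sum>i\<in>UNIV. \<Sum>j\<in>UNIV. of_int (C $ p $ i) * L $ i $ j * of_int (C $ q $ j))
       - (\<Sum>i\<in>UNIV. \<Sum>j\<in>UNIV. if p = i \<and> q = j then L $ i $ j else 0)"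
      unfolding sum_subtractf[symmetric] by (intro sum.cong refl) (auto simp: algebra_simps)
    also have "(\<Sum>i\<in>UNIV. \<Sum>j\<in>UNIV. of_int (C $ p $ i) * L $ i $ j * of_int (C $ q $ j)) = L $ p $ q"
      by (subst (2) fixed) (simp add: congruence_nth)
    also have "(\<Sum>i\<in>UNIV. \<Sum>j\<in>UNIV. if p = i \<and> q = j then L $ i $ j else 0)
       = (\<Sum>i\<in>UNIV. if i = p then (\<Sum>j\<in>UNIV. if j = q then L $ p $ j else 0) else 0)"
      by (intro sum.cong refl) auto
    also have "\<dots> = L $ p $ q" by simp
    finally have "(\<Sum>i\<in>UNIV. \<Sum>j\<in>UNIV. of_int (?c i j) * L $ i $ j) = 0" by simp
    from indep[OF this, of k l] show ?thesis by (simp add: algebra_simps)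
  qed
  obtain r where r: "\<And>j::'n. r j \<noteq> j" using two by metis
  \<comment> \<open>Column \<open>j\<close> of \<open>D\<close> is supported on \<open>j\<close> and
    \<open>r j\<close>, arranged so that the entry of \<open>C ** D\<close> at \<open>q\<close>,
    \<open>j\<close> is the minor of \<open>C\<close> with rows \<open>r j\<close>, \<open>q\<close>
    and columns \<open>r j\<close>, \<open>j\<close>.\<close>
  define D :: "int^'n::{finite,linorder}^'n::{finite,linorder}" where
    "D = (\<chi> l j. (if l = j then C $ r j $ r j else 0) - (if l = r j then C $ r j $ j else 0))"
  have "(\<Sum>l\<in>UNIV. C $ q $ l * D $ l $ j) = (if q = j then 1 else 0)" for q j
  proof -
    have "(\<Sum>l\<in>UNIV. C $ q $ l * D $ l $ j) =
       (\<Sum>l\<in>UNIV. (if l = j then C $ r j $ r j * C $ q $ j else 0) - (if l = r j then C $ r j $ j * C $ q $ r j else 0))"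
      by (intro sum.cong refl) (auto simp: D_def algebra_simps)
    also have "\<dots> = C $ r j $ r j * C $ q $ j - C $ r j $ j * C $ q $ r j"
      by (simp add: sum_subtractf)
    also have "\<dots> = (if q = j then 1 else 0)" using r[of j] by (simp add: minor)
    finally show ?thesis .
  qed
  then have "C ** D = mat 1" by (simp add: vec_eq_iff matrix_matrix_mult_def mat_def)
  then have "invertible C" using int_left_right_inverse unfolding invertible_def by blast
  then show ?thesis by (simp add: int_invertible_iff_abs_det)
qed

text \<open>Dividing by a generator of the entry subgroup turns both congruences into congruences of
  integer matrices.\<close>

lemma cyclic_entries_imp_unimodular_congruent:
  fixes L M :: "'k::field_char_0^'n^'n" and A B :: "int^'n^'n"
  assumes anti: "antisymmetric_mat L" and cyc: "cyclic_subgroup (entry_subgroup L)"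
    and M: "M = int_mat_to A ** L ** transpose (int_mat_to A)"
    and L: "L = int_mat_to B ** M ** transpose (int_mat_to B)"
  shows "\<exists>W :: int^'n^'n. invertible W \<and> M = int_mat_to W ** L ** transpose (int_mat_to W)"
proof -
  obtain g where g: "entry_subgroup L = range (\<lambda>m::int. of_int m * g)"
    using cyc unfolding cyclic_subgroup_def by blast
  have "L $ i $ j \<in> entry_subgroup L" for i j
  proof -
    have "(\<Sum>l\<in>UNIV. of_int (if k = i \<and> l = j then 1 else 0) * L $ k $ l)
       = (if k = i then L $ i $ j else 0)" for k
    proof -
      have "(\<Sum>l\<in>UNIV. of_int (if k = i \<and> l = j then 1 else 0) * L $ k $ l)
         = (\<Sum>l\<in>UNIV. if l = j then if k = i then L $ i $ j else 0 else 0)"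
        by (intro sum.cong refl) auto
      then show ?thesis by simp
    qed
    then have e: "L $ i $ j = (\<Sum>k\<in>UNIV. \<Sum>l\<in>UNIV. of_int (if k = i \<and> l = j then 1 else 0) * L $ k $ l)"
      by simp
    have "\<exists>c :: 'n \<Rightarrow> 'n \<Rightarrow> int. L $ i $ j = (\<Sum>k\<in>UNIV. \<Sum>l\<in>UNIV. of_int (c k l) * L $ k $ l)"
      by (intro exI[of _ "\<lambda>k l. if k = i \<and> l = j then 1 else 0"]) (rule e)
    then show ?thesis unfolding entry_subgroup_def by simp
  qed
  then have "\<exists>m::int. L $ i $ j = of_int m * g" for i j unfolding g by blast
  then obtain m where m: "\<And>i j. L $ i $ j = of_int (m i j) * g" by metis
  define X :: "int^'n^'n" where "X = (\<chi> i j. m i j)"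
  have LX: "L $ i $ j = of_int (X $ i $ j) * g" for i j by (simp add: X_def m)
  have scale: "(int_mat_to P ** N ** transpose (int_mat_to P)) $ a $ b = of_int ((P ** Z ** transpose P) $ a $ b) * g"
    if "\<And>i j. N $ i $ j = of_int (Z $ i $ j) * g" for P Z :: "int^'n^'n" and N :: "'k^'n^'n" and a b
    unfolding congruence_nth of_int_sum sum_distrib_right
    by (intro sum.cong refl) (simp add: that mult_ac)
  show ?thesis
  \<comment> \<open>A zero generator cannot be divided by, but then \<open>L\<close> and
    \<open>M\<close> both vanish and the identity matrix serves.\<close>
  proof (cases "g = 0")
    case True
    then have "L = 0" by (simp add: vec_eq_iff LX)
    then have "M = int_mat_to (mat 1) ** L ** transpose (int_mat_to (mat 1))" by (simp add: M)
    moreover have "invertible (mat 1 :: int^'n^'n)" by (auto simp: invertible_def)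
    ultimately show ?thesis by blast
  next
    case False
    define Y where "Y = A ** X ** transpose A"
    have MY: "M $ i $ j = of_int (Y $ i $ j) * g" for i j
      unfolding M Y_def by (rule scale) (rule LX)
    have "L $ i $ j = of_int ((B ** Y ** transpose B) $ i $ j) * g" for i j
      by (subst L, rule scale) (rule MY)
    then have "X = B ** Y ** transpose B" using False by (simp add: vec_eq_iff LX)
    moreover have "antisymmetric_mat X"
      using anti False unfolding antisymmetric_mat_nth LX
      by (metis mult_minus_left mult_right_cancel of_int_eq_iff of_int_minus)
    ultimately obtain W where W: "invertible W" "Y = W ** X ** transpose W"
      using mutually_congruent_imp_unimodular_congruent Y_def by blast
    have "M $ i $ j = (int_mat_to W ** L ** transpose (int_mat_to W)) $ i $ j" for i j
      unfolding scale[OF LX] W(2)[symmetric] by (rule MY)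
    then have "M = int_mat_to W ** L ** transpose (int_mat_to W)" by (simp add: vec_eq_iff)
    with W(1) show ?thesis by blast
  qed
qed

section \<open>From Poisson isomorphisms to congruences, and the equivalence\<close>

lemma poisson_iso_imp_congruent:
  fixes L M :: "('k::field_char_0^'n::{finite,linorder})^'n::{finite,linorder}"
  assumes "poisson_iso L M \<phi>"
  shows "\<exists>B :: int^'n::{finite,linorder}^'n::{finite,linorder}. L = int_mat_to B ** M ** transpose (int_mat_to B)"
proof (rule pbracket_multiplicative_imp_congruent[of "\<lambda>i. \<phi> (rf_var i)"])
  note iso = assms[unfolded poisson_iso_def]
  have \<phi>_0: "\<phi> 0 = 0" using iso by (metis add_0_right add_cancel_right_right)
  then show "\<phi> (rf_var i) \<noteq> 0" for i
    using iso rf_var_nonzero by (metis bij_is_inj injD)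
  show "pbracket M (\<phi> (rf_var i)) (\<phi> (rf_var j)) = rf_const (L $ i $ j) * \<phi> (rf_var i) * \<phi> (rf_var j)" for i j
    using iso pbracket_var[of L i j] by (metis mult.assoc)
qed

lemma poisson_iso_inv:
  assumes "poisson_iso L M \<phi>"
  shows "poisson_iso M L (inv \<phi>)"
proof -
  note iso = assms[unfolded poisson_iso_def]
  have bij: "bij \<phi>" using iso by blast
  have inv_eq: "inv \<phi> F = G \<longleftrightarrow> F = \<phi> G" for F G
    using bij by (metis bij_inv_eq_iff)
  have \<phi>_inv: "\<phi> (inv \<phi> F) = F" for F
    using bij by (simp add: bij_is_surj surj_f_inv_f)
  have hom: "\<phi> (F + G) = \<phi> F + \<phi> G" "\<phi> (F * G) = \<phi> F * \<phi> G" "\<phi> 1 = 1"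
    "\<phi> (pbracket L F G) = pbracket M (\<phi> F) (\<phi> G)" for F G
    using iso by blast+
  have const: "\<phi> (rf_const c) = rf_const c" for c
    using iso by (metis mult.right_neutral)
  show ?thesis
    unfolding poisson_iso_def inv_eq hom const \<phi>_inv using bij by (simp add: bij_imp_bij_inv)
qed

theorem theorem5p5:
  fixes L M :: "('k::field_char_0^'n::{finite,linorder})^('n::{finite,linorder})"
  assumes "antisymmetric_mat L" and "antisymmetric_mat M"
    and "invertible L \<or> cyclic_subgroup (entry_subgroup L) \<or>
         free_abelian_rank (entry_subgroup L) (CARD('n) * (CARD('n) - 1) div 2)"
  shows "poisson_isomorphic L M TYPE('n::{finite,linorder}) \<longleftrightarrow>
         (\<exists>A :: int^'n::{finite,linorder}^'n::{finite,linorder}. invertible A \<and>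
            M = int_mat_to A ** L ** transpose (int_mat_to A))"
proof
  assume "poisson_isomorphic L M TYPE('n)"
  then obtain \<phi> :: "('n, 'k) ratfun \<Rightarrow> ('n, 'k) ratfun" where iso: "poisson_iso L M \<phi>"
    unfolding poisson_isomorphic_def by blast
  obtain B :: "int^'n::{finite,linorder}^'n::{finite,linorder}" where B: "L = int_mat_to B ** M ** transpose (int_mat_to B)"
    using poisson_iso_imp_congruent[OF iso] by blast
  obtain A :: "int^'n::{finite,linorder}^'n::{finite,linorder}" where A: "M = int_mat_to A ** L ** transpose (int_mat_to A)"
    using poisson_iso_imp_congruent[OF poisson_iso_inv[OF iso]] by blast
  have fixed: "L = int_mat_to (B ** A) ** L ** transpose (int_mat_to (B ** A))"
    unfolding int_mat_to_mult congruence_trans[symmetric] A[symmetric] by (rule B)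
  show "\<exists>A :: int^'n::{finite,linorder}^'n::{finite,linorder}. invertible A \<and> M = int_mat_to A ** L ** transpose (int_mat_to A)"
  \<comment> \<open>In the cyclic case \<open>A\<close> itself may fail to be unimodular and another
    matrix is found; in the remaining cases \<open>A\<close> is unimodular.\<close>
  proof (cases "cyclic_subgroup (entry_subgroup L)")
    case True
    then show ?thesis using cyclic_entries_imp_unimodular_congruent[OF assms(1) _ A B] by blast
  next
    case False
    have "\<bar>det (B ** A)\<bar> = 1"
    proof (cases "invertible L")
      case True
      then show ?thesis using fixed by (intro abs_det_eq_1_if_congruence_fixes) (simp_all add: invertible_det_nz)
    next
      case notinv: False
      \<comment> \<open>With a single index antisymmetry gives \<open>L = 0\<close>, whose entry
        subgroup is cyclic. This is excluded here, so the argument by 2x2 minors has a second index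
        available.\<close>
      have "\<exists>i. i \<noteq> j" for j :: 'n
      proof (rule ccontr)
        assume "\<not> (\<exists>i. i \<noteq> j)"
        then have eq: "i = j" for i by blast
        have "L $ j $ j = - L $ j $ j" using assms(1) unfolding antisymmetric_mat_nth by blast
        then have "L $ j $ j = 0" by (simp add: eq_neg_iff_add_eq_0)
        then have "L $ i $ l = 0" for i l using eq[of i] eq[of l] by simp
        then have "entry_subgroup L = range (\<lambda>m::int. of_int m * 0)" by (auto simp: entry_subgroup_def)
        then show False using False unfolding cyclic_subgroup_def by blast
      qed
      then show ?thesis
        using assms(3) False notinv by (intro free_entries_fixed_imp_invertible[OF assms(1) _ fixed]) auto
    qed
    then have "invertible A" by (rule int_invertible_factors(1))
    with A show ?thesis by blast
  qed
next
  assume "\<exists>A :: int^'n::{finite,linorder}^'n::{finite,linorder}. invertible A \<and> M = int_mat_to A ** L ** transpose (int_mat_to A)"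
  then obtain A B :: "int^'n::{finite,linorder}^'n::{finite,linorder}" where AB: "A ** B = mat 1" "B ** A = mat 1"
    and M: "M = int_mat_to A ** L ** transpose (int_mat_to A)"
    unfolding invertible_def by blast
  \<comment> \<open>The congruence is inverted because the rows of the inverse of \<open>A\<close>
    are the exponents of the substitution.\<close>
  have "int_mat_to B ** M ** transpose (int_mat_to B) = L"
    unfolding M congruence_trans int_mat_to_mult[symmetric] AB int_mat_to_mat_1 by simp
  then show "poisson_isomorphic L M TYPE('n)"
    using congruent_imp_poisson_isomorphic[OF AB(2,1)] by metis
qed

end
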